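(* Let $g(u)=\cos(2\pi u)$ for $u\in\mathbb{R}$. For each integer $b\geqslant 2$ there exists $\lambda_b<1$ such that for every $\lambda\in(\lambda_b,1)$ with $b\lambda>1$ and $\lambda>0$ the graph $\{(x,W_{\lambda,b}(x)):x\in[0,1)\}\subset\mathbb{R}^2$ of the function $W_{\lambda,b}:[0,1)\to\mathbb{R}$, $W_{\lambda,b}(x)=\sum_{n=0}^\infty\lambda^n g(b^n x)$, has Hausdorff dimension $$D=2+\frac{\log\lambda}{\log b}.$$
   Context: $W_{\lambda,b}$ is the classical Weierstrass function. Its graph is an invariant set of the map $\Phi_{\lambda,b}:[0,1)\times\mathbb{R}\to[0,1)\times\mathbb{R}$, $\Phi_{\lambda,b}(u,v)=\left(bu \bmod 1,\frac{v-g(u)}{\lambda}\right)$. *)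

theory Defs
  imports "HOL-Analysis.Analysis"
begin

text \<open>
  The s-th power of the diameter of a set, for s \<open>\<ge>\<close> 0, with the usual conventions of Hausdorff
  measure theory: the empty set contributes 0, and a nonempty set contributes 1 if s = 0
  (whereas \<open>0 powr 0 = 0\<close>). Only meaningful for bounded U, since diameter is unspecified otherwise.
\<close>
definition diam_power :: "real \<Rightarrow> 'a::metric_space set \<Rightarrow> ennreal" where
  "diam_power s U =
     (if U = {} then 0 else if s = 0 then 1 else ennreal (diameter U powr s))"

text \<open>Coverings are sequences of arbitrary sets; finite coverings are included as sequences padded
  with empty sets. The infimum is infinite if there is no admissible covering.\<close>
definition delta_covers :: "real \<Rightarrow> 'a::metric_space set \<Rightarrow> (nat \<Rightarrow> 'a set) set" where
  "delta_covers \<delta> A =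
     {U. A \<subseteq> (\<Union>i. U i) \<and> (\<forall>i. bounded (U i) \<and> diameter (U i) \<le> \<delta>)}"

definition hausdorff_premeasure :: "real \<Rightarrow> real \<Rightarrow> 'a::metric_space set \<Rightarrow> ennreal" where
  "hausdorff_premeasure s \<delta> A = (INF U\<in>delta_covers \<delta> A. \<Sum>i. diam_power s (U i))"

text \<open>The unnormalised s-dimensional Hausdorff (outer) measure.\<close>
definition hausdorff_measure :: "real \<Rightarrow> 'a::metric_space set \<Rightarrow> ennreal" where
  "hausdorff_measure s A = (SUP \<delta>\<in>{0<..}. hausdorff_premeasure s \<delta> A)"

definition hausdorff_dim :: "'a::metric_space set \<Rightarrow> ereal" where
  "hausdorff_dim A = (INF s\<in>{s. 0 \<le> s \<and> hausdorff_measure s A = 0}. ereal s)"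

definition weierstrass_fun :: "(real \<Rightarrow> real) \<Rightarrow> real \<Rightarrow> nat \<Rightarrow> real \<Rightarrow> real" where
  "weierstrass_fun g lam b x = (\<Sum>n. lam ^ n * g (real b ^ n * x))"

end

(*
  Fourier decay of the occupation measure replaces the usual route through dynamics. Split the first
  m digits off x: since W(x) = G(x) + lam^m W(b^m x), an oscillatory integral of psi e^(i eta W) equals
  the integral of (T psi) e^(i eta lam^m W), where T averages psi e^(i eta G) over the b^m inverse
  branches of x -> b^m x. Branches whose last p digits are all 0 and branches whose last p digits are
  all b - 1 have uniformly separated phase derivatives, so integration by parts kills their
  correlation, and T contracts the norm |psi|^2 + beta |psi'|^2 / eta^2 by a factor theta < 1. The
  numbers p, m, beta, theta depend on b only, whereas the frequency only drops from eta to lam^m eta.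
  For lam so close to 1 that theta <= lam^(4 m), the integrals decay like eta^(-2), hence W
  restricted to a b-adic interval and rescaled has a bounded occupation density, uniformly over all
  intervals. Thus Lebesgue measure lifted to the graph gives mass O(d^D) to every set of diameter d.
*)
theory Submission
  imports Defs
begin

section \<open>Oscillatory integrals on the unit interval\<close>

text \<open>The contraction is an L^2 effect, but integration by parts costs a derivative of \<psi>;
  hence the mixed norm. Its weight 1 / \<eta>^2 is natural: differentiating a branch term of T
  \<psi> either gains b^(-m) from the inverse branch or brings down a phase derivative of order
  \<eta> * lam^m, which is just the frequency after the step. The second contribution is bounded but
  not small, so \<beta> has to be small against the L^2 gain. The exponent 4 in theta <= lam^(4 m)
  is set by the application: squared integrals of order \<eta>^(-4) make the integrals summable over
  integer frequencies, and this gives a bounded density. As theta < 1 is fixed by b while lam^(4 m)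
  tends to 1, the inequality holds for lam near 1. Uniformity over intervals comes from the same
  norm: on a level-n cell, W / lam^n is a copy of W plus a phase with bounded derivative, which can
  be moved into \<psi>. In a cell of length b^(-n) comparable to d, W then spends time at most of
  order b^(-n) * d / lam^n in a window of height d, and this is of order d^D.\<close>

lemma continuous_integrable_on_interval:
  fixes f :: "real \<Rightarrow> 'a::banach"
  assumes "continuous_on UNIV f"
  shows "f integrable_on {a..b}"
  using assms continuous_on_subset integrable_continuous_interval by blast

lemma integral_cell:
  fixes f :: "real \<Rightarrow> 'a::banach"
  assumes "continuous_on UNIV f" "0 < B"
  shows "integral {a / B..(a + 1) / B} f = integral {0..1} (\<lambda>v. f ((a + v) / B)) /\<^sub>R B"
proof -
  have "(f has_integral integral {a / B..(a + 1) / B} f) (cbox (a / B) ((a + 1) / B))"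
    using continuous_integrable_on_interval[OF assms(1)] by auto
  note * = has_integral_affinity'[OF this, of "1 / B" "a / B"]
  have "((\<lambda>v. f ((a + v) / B)) has_integral B *\<^sub>R integral {a / B..(a + 1) / B} f) {0..1}"
  proof -
    have "(a + 1) / B - a / B = 1 / B"
      by (simp add: diff_divide_distrib[symmetric])
    with * assms(2) show ?thesis
      by (simp add: add_divide_distrib add.commute)
  qed
  then have "integral {0..1} (\<lambda>v. f ((a + v) / B)) = B *\<^sub>R integral {a / B..(a + 1) / B} f"
    by (rule integral_unique)
  then show ?thesis
    using assms(2) by simp
qed

lemma integral_split_cells:
  fixes f :: "real \<Rightarrow> 'a::banach" and B :: nat
  assumes f: "continuous_on UNIV f" and "0 < B"
  shows "integral {0..1} f = (\<Sum>C<B. integral {0..1} (\<lambda>v. f ((real C + v) / real B))) /\<^sub>R real B"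
proof -
  have "integral {0..real n / real B} f =
      (\<Sum>C<n. integral {0..1} (\<lambda>v. f ((real C + v) / real B))) /\<^sub>R real B" for n
  proof (induction n)
    case (Suc n)
    have "integral {0..real (Suc n) / real B} f =
        integral {0..real n / real B} f + integral {real n / real B..(real n + 1) / real B} f"
      using assms(2)
      by (subst Henstock_Kurzweil_Integration.integral_combine[symmetric, where c = "real n / real B"])
         (auto simp: add.commute divide_right_mono intro!: continuous_integrable_on_interval[OF f])
    then show ?case
      using integral_cell[OF f, of "real B" "real n"] assms(2) Suc.IH by (simp add: scaleR_add_right)
  qed auto
  from this[of B] show ?thesis
    using assms(2) by simp
qed

text \<open>Compare \<open>h x\<close> with \<open>h v\<close> by the fundamental theorem of
  calculus and average over \<open>v\<close>: a one-dimensional Sobolev bound. It turns the boundary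
  terms of an integration by parts into integrals.\<close>

lemma norm_le_integral_plus_integral_derivative:
  fixes h :: "real \<Rightarrow> complex"
  assumes h: "\<And>x. (h has_vector_derivative h' x) (at x)"
    and h': "continuous_on UNIV h'" and x: "x \<in> {0..1}"
  shows "norm (h x) \<le> integral {0..1} (\<lambda>v. norm (h v)) + integral {0..1} (\<lambda>v. norm (h' v))"
proof -
  let ?I = "integral {0..1} (\<lambda>v. norm (h' v))"
  have ch: "continuous_on UNIV h"
    using h by (meson continuous_at_imp_continuous_on has_vector_derivative_continuous)
  have diff: "norm (h t - h s) \<le> ?I" if "0 \<le> s" "s \<le> t" "t \<le> 1" for s t
  proof -
    have "(h' has_integral h t - h s) {s..t}"
      using that h by (intro fundamental_theorem_of_calculus) (auto intro: has_vector_derivative_at_within)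
    then have "norm (h t - h s) \<le> integral {s..t} (\<lambda>v. norm (h' v))"
      by (metis Henstock_Kurzweil_Integration.integral_norm_bound_integral
          continuous_integrable_on_interval continuous_on_norm h' has_integral_iff order_refl)
    also have "\<dots> \<le> ?I"
      using that h' by (intro integral_subset_le)
        (auto intro!: continuous_integrable_on_interval continuous_intros)
    finally show ?thesis .
  qed
  have "norm (h x) \<le> norm (h v) + ?I" if "v \<in> {0..1}" for v
    using diff[of v x] diff[of x v] x that norm_triangle_ineq2[of "h x" "h v"]
    by (cases "v \<le> x") (auto simp: norm_minus_commute)
  then have "integral {0..1::real} (\<lambda>v. norm (h x)) \<le> integral {0..1} (\<lambda>v. norm (h v) + ?I)"
    by (intro integral_le) (auto intro!: continuous_integrable_on_interval continuous_intros ch)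
  also have "\<dots> = integral {0..1} (\<lambda>v. norm (h v)) + ?I"
    by (subst Henstock_Kurzweil_Integration.integral_add)
      (auto intro!: continuous_integrable_on_interval continuous_intros ch)
  finally show ?thesis by simp
qed

text \<open>One integration by parts. Each boundary term costs the integrals of |h| and |h'| once;
  the remainder adds the integral of |h'| and \<open>M / k\<close> times that of |h|. This accounts
  for the constants \<open>2 + M / k\<close> and \<open>3\<close>.\<close>

lemma nonstationary_phase:
  fixes h :: "real \<Rightarrow> complex" and \<phi> :: "real \<Rightarrow> real"
  assumes h: "\<And>x. (h has_vector_derivative h' x) (at x)" and h': "continuous_on UNIV h'"
    and \<phi>: "\<And>x. (\<phi> has_real_derivative \<phi>' x) (at x)"
    and \<phi>': "\<And>x. (\<phi>' has_real_derivative \<phi>'' x) (at x)" and \<phi>'': "continuous_on UNIV \<phi>''"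
    and lower: "\<And>x. x \<in> {0..1} \<Longrightarrow> k \<le> \<bar>\<phi>' x\<bar>" and upper: "\<And>x. x \<in> {0..1} \<Longrightarrow> \<bar>\<phi>'' x\<bar> \<le> M"
    and k: "0 < k" and \<eta>: "0 < \<eta>"
  shows "norm (integral {0..1} (\<lambda>x. h x * cis (\<eta> * \<phi> x))) \<le>
    ((2 + M / k) * integral {0..1} (\<lambda>x. norm (h x)) + 3 * integral {0..1} (\<lambda>x. norm (h' x))) / (\<eta> * k)"
proof -
  let ?H = "integral {0..1} (\<lambda>x. norm (h x))" and ?H' = "integral {0..1} (\<lambda>x. norm (h' x))"
  have ch: "continuous_on UNIV h"
    using h by (meson continuous_at_imp_continuous_on has_vector_derivative_continuous)
  have c\<phi>: "continuous_on UNIV \<phi>" "continuous_on UNIV \<phi>'"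
    using \<phi> \<phi>' by (meson DERIV_isCont continuous_at_imp_continuous_on)+
  have nz: "\<phi>' x \<noteq> 0" if "x \<in> {0..1}" for x
    using lower[OF that] k by auto
  define F where "F x = h x * cis (\<eta> * \<phi> x) / (\<i> * \<eta> * \<phi>' x)" for x
  \<comment> \<open>The derivative of \<open>h / (\<i> * \<eta> * \<phi>')\<close> times the
    exponential: what the product rule for \<open>F\<close> leaves beside the integrand.\<close>
  define R where "R x = (h' x / (\<i> * \<eta> * \<phi>' x) - h x * \<phi>'' x / (\<i> * \<eta> * (\<phi>' x)\<^sup>2)) * cis (\<eta> * \<phi> x)" for x
  have F': "(F has_vector_derivative (h x * cis (\<eta> * \<phi> x) + R x)) (at x within {0..1})"
    if x: "x \<in> {0..1}" for x
  proof -
    have d1: "((\<lambda>x. of_real (\<phi>' x)) has_vector_derivative (of_real (\<phi>'' x) :: complex)) (at x)"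
      using \<phi>'[of x] by (intro has_vector_derivative_of_real)
        (simp add: has_real_derivative_iff_has_vector_derivative)
    have d2: "((\<lambda>x. inverse (of_real (\<phi>' x))) has_vector_derivative
        (- (of_real (\<phi>'' x) / (of_real (\<phi>' x))\<^sup>2) :: complex)) (at x)"
    proof -
      have "((\<lambda>x. inverse (\<phi>' x)) has_real_derivative (- (\<phi>'' x / (\<phi>' x)\<^sup>2))) (at x)"
        using \<phi>'[of x] nz[OF x] by (auto intro!: derivative_eq_intros simp: power2_eq_square field_simps)
      then have "((\<lambda>x. of_real (inverse (\<phi>' x))) has_vector_derivative
        (of_real (- (\<phi>'' x / (\<phi>' x)\<^sup>2)) :: complex)) (at x)"
        by (intro has_vector_derivative_of_real) (simp add: has_real_derivative_iff_has_vector_derivative)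
      then show ?thesis by simp
    qed
    have d3: "((\<lambda>x. cis (\<eta> * \<phi> x)) has_vector_derivative (\<eta> * \<phi>' x) *\<^sub>R (\<i> * cis (\<eta> * \<phi> x))) (at x)"
      unfolding has_vector_derivative_def
      using \<phi>[of x] by (auto intro!: derivative_eq_intros simp: has_field_derivative_def algebra_simps)
    have "((\<lambda>x. (h x * cis (\<eta> * \<phi> x)) * inverse (of_real (\<phi>' x)) * inverse (\<i> * \<eta>)) has_vector_derivative
      (((h x * cis (\<eta> * \<phi> x)) * (- (of_real (\<phi>'' x) / (of_real (\<phi>' x))\<^sup>2)) +
       (h x * ((\<eta> * \<phi>' x) *\<^sub>R (\<i> * cis (\<eta> * \<phi> x))) + h' x * cis (\<eta> * \<phi> x)) * inverse (of_real (\<phi>' x)))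
        * inverse (\<i> * \<eta>))) (at x)"
      by (intro has_vector_derivative_mult_left has_vector_derivative_mult h d2 d3)
    also have "(\<lambda>x. (h x * cis (\<eta> * \<phi> x)) * inverse (of_real (\<phi>' x)) * inverse (\<i> * \<eta>)) = F"
      by (auto simp: F_def field_simps)
    also have "((h x * cis (\<eta> * \<phi> x)) * (- (of_real (\<phi>'' x) / (of_real (\<phi>' x))\<^sup>2)) +
       (h x * ((\<eta> * \<phi>' x) *\<^sub>R (\<i> * cis (\<eta> * \<phi> x))) + h' x * cis (\<eta> * \<phi> x)) * inverse (of_real (\<phi>' x)))
        * inverse (\<i> * \<eta>) = h x * cis (\<eta> * \<phi> x) + R x"
      using nz[OF x] \<eta> by (simp add: R_def scaleR_conv_of_real field_simps power2_eq_square)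
    finally show ?thesis
      by (rule has_vector_derivative_at_within)
  qed
  have ftc: "((\<lambda>x. h x * cis (\<eta> * \<phi> x) + R x) has_integral F 1 - F 0) {0..1}"
    by (intro fundamental_theorem_of_calculus F') auto
  have intg: "(\<lambda>x. h x * cis (\<eta> * \<phi> x)) integrable_on {0..1}"
    by (intro continuous_integrable_on_interval continuous_intros ch c\<phi>)
  then have intR: "(R has_integral (F 1 - F 0) - integral {0..1} (\<lambda>x. h x * cis (\<eta> * \<phi> x))) {0..1}"
    using has_integral_diff[OF ftc integrable_integral[OF intg]] by simp
  have boundR: "norm (R x) \<le> (norm (h' x) + M / k * norm (h x)) / (\<eta> * k)" if x: "x \<in> {0..1}" for x
  proof -
    have "norm (R x) \<le> norm (h' x) / (\<eta> * \<bar>\<phi>' x\<bar>) + norm (h x) * \<bar>\<phi>'' x\<bar> / (\<eta> * (\<phi>' x)\<^sup>2)"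
      unfolding R_def using \<eta>
      by (simp add: norm_mult norm_divide norm_power order_trans[OF norm_triangle_ineq4])
    also have "norm (h' x) / (\<eta> * \<bar>\<phi>' x\<bar>) \<le> norm (h' x) / (\<eta> * k)"
      using lower[OF x] k \<eta> by (intro divide_left_mono mult_left_mono) auto
    also have "norm (h x) * \<bar>\<phi>'' x\<bar> / (\<eta> * (\<phi>' x)\<^sup>2) \<le> norm (h x) * M / (\<eta> * k\<^sup>2)"
    proof (intro frac_le mult_left_mono upper[OF x])
      show "k\<^sup>2 \<le> (\<phi>' x)\<^sup>2"
        using lower[OF x] k by (metis abs_le_square_iff abs_of_pos)
      show "0 \<le> norm (h x) * M"
        using upper[OF x] by (simp add: order_trans[OF abs_ge_zero])
    qed (use k \<eta> in auto)
    also have "norm (h x) * M / (\<eta> * k\<^sup>2) = (M / k * norm (h x)) / (\<eta> * k)"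
      by (simp add: power2_eq_square mult_ac)
    finally show ?thesis by (simp add: add_divide_distrib)
  qed
  have "norm (integral {0..1} R) \<le> integral {0..1} (\<lambda>x. (norm (h' x) + M / k * norm (h x)) / (\<eta> * k))"
  proof (rule Henstock_Kurzweil_Integration.integral_norm_bound_integral[OF _ _ boundR])
    show "R integrable_on {0..1}" using intR by blast
    show "(\<lambda>x. (norm (h' x) + M / k * norm (h x)) / (\<eta> * k)) integrable_on {0..1}"
      using k \<eta> by (intro continuous_integrable_on_interval continuous_intros ch h') auto
  qed
  also have "\<dots> = (?H' + M / k * ?H) / (\<eta> * k)"
  proof -
    have "((\<lambda>x. (norm (h' x) + M / k * norm (h x)) / (\<eta> * k)) has_integral (?H' + M / k * ?H) / (\<eta> * k)) {0..1}"
      by (intro has_integral_divide has_integral_add has_integral_mult_right integrable_integral)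
         (auto intro!: continuous_integrable_on_interval continuous_intros ch h')
    then show ?thesis by (rule integral_unique)
  qed
  finally have R: "norm (integral {0..1} R) \<le> (?H' + M / k * ?H) / (\<eta> * k)" .
  have Fb: "norm (F x) \<le> (?H + ?H') / (\<eta> * k)" if x: "x \<in> {0..1}" for x
  proof -
    have "norm (F x) = norm (h x) / (\<eta> * \<bar>\<phi>' x\<bar>)"
      using \<eta> by (simp add: F_def norm_mult norm_divide)
    also have "\<dots> \<le> (?H + ?H') / (\<eta> * k)"
      using norm_le_integral_plus_integral_derivative[OF h h' x] lower[OF x] k \<eta>
      by (intro frac_le mult_left_mono) (auto intro: order_trans[OF norm_ge_zero])
    finally show ?thesis .
  qed
  have "integral {0..1} (\<lambda>x. h x * cis (\<eta> * \<phi> x)) = F 1 - F 0 - integral {0..1} R"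
    using intR by (simp add: has_integral_iff)
  then have "norm (integral {0..1} (\<lambda>x. h x * cis (\<eta> * \<phi> x))) \<le>
      norm (F 1) + norm (F 0) + norm (integral {0..1} R)"
    by (metis norm_triangle_ineq4 add_right_mono order_trans)
  also have "\<dots> \<le> (?H + ?H') / (\<eta> * k) + (?H + ?H') / (\<eta> * k) + (?H' + M / k * ?H) / (\<eta> * k)"
    by (intro add_mono R Fb) auto
  also have "\<dots> = ((2 + M / k) * ?H + 3 * ?H') / (\<eta> * k)"
    by (simp add: add_divide_distrib[symmetric] algebra_simps)
  finally show ?thesis .
qed

text \<open>Without the correlation of \<open>X 0\<close> and \<open>X (P - 1)\<close> the constant \<open>P\<close> of Cauchy--Schwarz can be
  lowered; this gain is the source of the contraction.\<close>

lemma norm_sum_squared_le_except_pair: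
  fixes X :: "nat \<Rightarrow> complex" and P :: nat
  assumes "4 \<le> P"
  shows "(norm (\<Sum>q<P. X q))\<^sup>2 \<le>
    (real P - 2 / (real P - 1)) * (\<Sum>q<P. (norm (X q))\<^sup>2) + (real P + 1) * Re (X 0 * cnj (X (P - 1)))"
proof -
  define S where "S = X 0 + X (P - 1)"
  define R where "R = (\<Sum>q\<in>{1..<P - 1}. X q)"
  define r where "r = (\<Sum>q\<in>{1..<P - 1}. (norm (X q))\<^sup>2)"
  define p where "p = real P"
  have p: "4 \<le> p" using assms by (simp add: p_def)
  have split: "{..<P} = insert 0 (insert (P - 1) {1..<P - 1})" using assms by auto
  have sumX: "(\<Sum>q<P. X q) = S + R" unfolding split S_def R_def using assms by auto
  have sumN: "(\<Sum>q<P. (norm (X q))\<^sup>2) = (norm (X 0))\<^sup>2 + (norm (X (P - 1)))\<^sup>2 + r"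
    unfolding split r_def using assms by auto
  have "norm R \<le> (\<Sum>q\<in>{1..<P - 1}. norm (X q))" unfolding R_def by (rule norm_sum)
  then have "(norm R)\<^sup>2 \<le> (\<Sum>q\<in>{1..<P - 1}. norm (X q))\<^sup>2" by (simp add: power_mono)
  also have "\<dots> \<le> (\<Sum>q\<in>{1..<P - 1}. 1\<^sup>2) * r" unfolding r_def
    using Cauchy_Schwarz_ineq_sum[of "\<lambda>_. 1" "\<lambda>q. norm (X q)" "{1..<P - 1}"] by simp
  also have "\<dots> = (p - 2) * r" using assms by (simp add: p_def of_nat_diff)
  finally have R: "(norm R)\<^sup>2 \<le> (p - 2) * r" .
  have S: "(norm S)\<^sup>2 = (norm (X 0))\<^sup>2 + (norm (X (P - 1)))\<^sup>2 + 2 * Re (X 0 * cnj (X (P - 1)))"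
    unfolding S_def cmod_power2 by (simp add: power2_eq_square algebra_simps)
  \<comment> \<open>Weight in Young's inequality for \<open>S + R\<close>. The value (p - 2) / 2
    would reproduce the constant p on both parts. Anything larger lowers the constant on
    \<open>R\<close>, and there is room on \<open>S\<close>: without the cross term its two summands
    cost 1 + s instead of 2 * (1 + s).\<close>
  define s where "s = (p - 1) / 2"
  have s: "0 < s" using p by (simp add: s_def)
  have "0 \<le> (sqrt s * norm S - norm R / sqrt s)\<^sup>2" by simp
  also have "\<dots> = s * (norm S)\<^sup>2 + (norm R)\<^sup>2 / s - 2 * norm S * norm R"
    using s by (simp add: power2_diff power_mult_distrib power_divide)
  finally have am: "2 * norm S * norm R \<le> s * (norm S)\<^sup>2 + (norm R)\<^sup>2 / s" by simp
  have "(norm (S + R))\<^sup>2 \<le> (norm S + norm R)\<^sup>2" by (simp add: power_mono norm_triangle_ineq)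
  also have "\<dots> \<le> (1 + s) * (norm S)\<^sup>2 + (1 + 1 / s) * (norm R)\<^sup>2"
    using am by (simp add: power2_sum algebra_simps)
  also have "\<dots> \<le> (1 + s) * (norm S)\<^sup>2 + (1 + 1 / s) * ((p - 2) * r)"
    using s R by (intro add_left_mono mult_left_mono) auto
  also have "(1 + 1 / s) * ((p - 2) * r) = (p - 2 / (p - 1)) * r"
    using p unfolding s_def by (simp add: field_simps)
  also have "(1 + s) * (norm S)\<^sup>2 =
      (1 + s) * ((norm (X 0))\<^sup>2 + (norm (X (P - 1)))\<^sup>2) + (p + 1) * Re (X 0 * cnj (X (P - 1)))"
    unfolding S s_def by (simp add: field_simps)
  also have "(1 + s) * ((norm (X 0))\<^sup>2 + (norm (X (P - 1)))\<^sup>2) \<le>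
      (p - 2 / (p - 1)) * ((norm (X 0))\<^sup>2 + (norm (X (P - 1)))\<^sup>2)"
  proof (intro mult_right_mono)
    have "2 / (p - 1) \<le> 1" using p by simp
    moreover have "1 + s \<le> p - 1" using p unfolding s_def by (simp add: field_simps)
    ultimately show "1 + s \<le> p - 2 / (p - 1)" by linarith
  qed auto
  finally show ?thesis unfolding sumX sumN p_def by (simp add: algebra_simps)
qed

section \<open>Partial sums of the Weierstrass function\<close>

text \<open>A weak Jordan inequality from the Taylor polynomial: the error x^3 / 6 is at most 2 * x
  / 3 because x <= 2.\<close>

lemma sin_ge_third:
  assumes "0 \<le> x" "x \<le> pi / 2"
  shows "x / 3 \<le> sin (x::real)"
proof -
  have "\<bar>sin x - x\<bar> \<le> \<bar>x\<bar> ^ 3 / 6"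
  proof -
    have 1: "(\<Sum>m<3. sin_coeff m * x ^ m) = x"
      by (simp add: eval_nat_numeral sin_coeff_def)
    have 2: "inverse (fact 3) = (1 / 6 :: real)"
      by (simp add: fact_numeral)
    show ?thesis
      using Maclaurin_sin_bound[of x 3] unfolding 1 2 by simp
  qed
  moreover have "\<bar>x\<bar> ^ 3 / 6 \<le> 2 * x / 3"
  proof -
    have "x \<le> 2" using assms(2) pi_less_4 by linarith
    then have "x * x \<le> 2 * 2" using assms(1) by (intro mult_mono) auto
    then have "x * (x * x) \<le> x * 4" using assms(1) by (intro mult_left_mono) auto
    then show ?thesis using assms(1) by (simp add: power3_eq_cube)
  qed
  ultimately show ?thesis by linarith
qed

lemma geometric_sum_le:
  fixes q :: real
  assumes "3 / 2 \<le> q"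
  shows "(\<Sum>j<m. q ^ j) \<le> 2 * q ^ m"
proof -
  have "(1 / 2) * (\<Sum>j<m. q ^ j) \<le> (q - 1) * (\<Sum>j<m. q ^ j)"
    using assms by (intro mult_right_mono sum_nonneg) auto
  also have "\<dots> = q ^ m - 1"
    by (metis power_diff_1_eq)
  finally show ?thesis by simp
qed

text \<open>Writes an index as \<open>P * D + q\<close>. With \<open>P = b ^ p\<close>, the residue
  \<open>q\<close> holds the last \<open>p\<close> base-b digits of a branch index and
  \<open>D\<close> the leading ones.\<close>

lemma sum_lessThan_mult:
  fixes f :: "nat \<Rightarrow> 'a::comm_monoid_add"
  shows "(\<Sum>C<P * N. f C) = (\<Sum>q<P. \<Sum>D<N. f (P * D + q))"
proof -
  have "(\<Sum>C<P * N. f C) = (\<Sum>D<N. \<Sum>q<P. f (P * D + q))"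
  proof (induction N)
    case (Suc N)
    have "{..<P * Suc N} = {..<P * N} \<union> {P * N..<P * N + P}" by auto
    then have "(\<Sum>C<P * Suc N. f C) = (\<Sum>C<P * N. f C) + (\<Sum>C\<in>{P * N..<P * N + P}. f C)"
      by (simp add: sum.union_disjoint ivl_disj_int)
    also have "(\<Sum>C\<in>{P * N..<P * N + P}. f C) = (\<Sum>q<P. f (P * N + q))"
      using sum.shift_bounds_nat_ivl[of f 0 "P * N" P] by (simp add: lessThan_atLeast0 add.commute)
    finally show ?case using Suc.IH by simp
  qed simp
  also have "\<dots> = (\<Sum>q<P. \<Sum>D<N. f (P * D + q))"
    by (rule sum.swap)
  finally show ?thesis .
qed

lemma norm_sum_squared_le:
  fixes z :: "nat \<Rightarrow> complex"
  shows "(norm (\<Sum>D<N. z D))\<^sup>2 \<le> real N * (\<Sum>D<N. (norm (z D))\<^sup>2)"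
proof -
  have "(norm (\<Sum>D<N. z D))\<^sup>2 \<le> (\<Sum>D<N. norm (z D))\<^sup>2"
    by (simp add: power_mono norm_sum)
  also have "\<dots> \<le> real N * (\<Sum>D<N. (norm (z D))\<^sup>2)"
    using Cauchy_Schwarz_ineq_sum[of "\<lambda>_. 1" "\<lambda>D. norm (z D)" "{..<N}"] by simp
  finally show ?thesis .
qed

text \<open>The bound 3/4 together with b >= 2 gives lam * b >= 3/2. Geometric sums with ratio lam *
  b are then dominated by their last terms, with constants independent of lam.\<close>

locale weierstrass_parameters =
  fixes b :: nat and lam :: real
  assumes b: "2 \<le> b" and lam_lower: "3 / 4 \<le> lam" and lam_upper: "lam < 1"
begin

abbreviation W :: "real \<Rightarrow> real" where
  "W \<equiv> weierstrass_fun (\<lambda>u. cos (2 * pi * u)) lam b"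

definition partial :: "nat \<Rightarrow> real \<Rightarrow> real" where
  "partial m x = (\<Sum>j<m. lam ^ j * cos (2 * pi * (real b ^ j * x)))"

text \<open>The weights grow geometrically, so the terms with \<open>j\<close> near \<open>m\<close>
  dominate. At x = (C + v) / b^m these depend, modulo the period, only on \<open>v\<close> and the
  last m - j digits of \<open>C\<close>; this is why fixing the last digits of a branch controls its
  phase derivative.\<close>

definition partial_deriv :: "nat \<Rightarrow> real \<Rightarrow> real" where
  "partial_deriv m x = - (2 * pi) * (\<Sum>j<m. (lam * b) ^ j * sin (2 * pi * (real b ^ j * x)))"

definition partial_deriv2 :: "nat \<Rightarrow> real \<Rightarrow> real" where
  "partial_deriv2 m x = - (2 * pi)\<^sup>2 * (\<Sum>j<m. (lam * b\<^sup>2) ^ j * cos (2 * pi * (real b ^ j * x)))"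

text \<open>The phase of the inverse branch \<open>v \<mapsto> (C + v) / b ^ m\<close> of \<open>x \<mapsto> b ^ m x\<close>.\<close>

definition phase :: "nat \<Rightarrow> nat \<Rightarrow> real \<Rightarrow> real" where
  "phase m C v = partial m ((real C + v) / real b ^ m)"

definition phase_deriv :: "nat \<Rightarrow> nat \<Rightarrow> real \<Rightarrow> real" where
  "phase_deriv m C v = partial_deriv m ((real C + v) / real b ^ m) / real b ^ m"

definition phase_deriv2 :: "nat \<Rightarrow> nat \<Rightarrow> real \<Rightarrow> real" where
  "phase_deriv2 m C v = partial_deriv2 m ((real C + v) / real b ^ m) / (real b ^ m)\<^sup>2"

section \<open>Convergence, periodicity and self-affinity of the series\<close>

lemma lam_pos: "0 < lam"
  using lam_lower by simp

lemma b_pos: "0 < real b"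
  using b by simp

lemma lam_b: "3 / 2 \<le> lam * real b"
  using mult_mono[of "3 / 4" lam 2 "real b"] b lam_lower by simp

lemma W_term_bound: "norm (lam ^ n * cos (2 * pi * (real b ^ n * x))) \<le> lam ^ n"
  using lam_pos by (simp add: abs_mult mult_left_le)

lemma summable_lam: "summable (\<lambda>n. lam ^ n)"
  using lam_pos lam_upper by (intro summable_geometric) simp

lemma summable_W: "summable (\<lambda>n. lam ^ n * cos (2 * pi * (real b ^ n * x)))"
  using W_term_bound summable_lam by (rule summable_comparison_test'[where N = 0, rotated])

lemma continuous_W: "continuous_on UNIV W"
proof (rule uniform_limit_theorem)
  show "uniform_limit UNIV (\<lambda>n x. \<Sum>i<n. lam ^ i * cos (2 * pi * (real b ^ i * x))) W sequentially"
    unfolding weierstrass_fun_def by (rule Weierstrass_m_test[OF W_term_bound summable_lam])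
qed (auto intro!: always_eventually continuous_intros)

lemma W_shift: "W (of_int k + x) = W x"
proof -
  have "cos (2 * pi * (real b ^ n * (of_int k + x))) = cos (2 * pi * (real b ^ n * x))" for n
  proof -
    have "2 * pi * (real b ^ n * (of_int k + x)) =
        2 * pi * (real b ^ n * x) + (2 * pi) * of_int (int b ^ n * k)"
      by (simp add: algebra_simps)
    then show ?thesis by (simp only: cos_add cos_int_2pin sin_int_2pin mult_1_right mult_zero_right diff_zero)
  qed
  then show ?thesis by (simp add: weierstrass_fun_def)
qed

lemma W_split: "W x = partial m x + lam ^ m * W (real b ^ m * x)"
proof -
  have "W x = (\<Sum>n. lam ^ (n + m) * cos (2 * pi * (real b ^ (n + m) * x))) + partial m x"
    unfolding weierstrass_fun_def partial_def by (rule suminf_split_initial_segment[OF summable_W])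
  also have "(\<Sum>n. lam ^ (n + m) * cos (2 * pi * (real b ^ (n + m) * x))) =
      (\<Sum>n. lam ^ m * (lam ^ n * cos (2 * pi * (real b ^ n * (real b ^ m * x)))))"
    by (simp add: power_add mult_ac)
  also have "\<dots> = lam ^ m * W (real b ^ m * x)"
    unfolding weierstrass_fun_def by (rule suminf_mult[OF summable_W])
  finally show ?thesis by simp
qed

lemma abs_W_le: "\<bar>W x\<bar> \<le> 1 / (1 - lam)"
proof -
  have "\<bar>W x\<bar> \<le> (\<Sum>n. lam ^ n)"
    unfolding weierstrass_fun_def real_norm_def[symmetric]
    by (rule norm_suminf_le[OF W_term_bound summable_lam])
  then show ?thesis
    using suminf_geometric[of lam] lam_pos lam_upper by simp
qed

section \<open>Derivative bounds for partial sums and phases\<close>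

lemma partial_has_derivative: "(partial m has_real_derivative partial_deriv m x) (at x)"
proof -
  have "((\<lambda>x. \<Sum>j<m. lam ^ j * cos (2 * pi * (real b ^ j * x))) has_real_derivative
      (\<Sum>j<m. lam ^ j * (- sin (2 * pi * (real b ^ j * x)) * (2 * pi * real b ^ j)))) (at x)"
    by (auto intro!: derivative_eq_intros simp: mult_ac)
  then show ?thesis
    by (simp add: partial_def[abs_def] partial_deriv_def sum_distrib_left sum_negf mult_ac power_mult_distrib)
qed

lemma partial_deriv_has_derivative: "(partial_deriv m has_real_derivative partial_deriv2 m x) (at x)"
proof -
  have "((\<lambda>x. - (2 * pi) * (\<Sum>j<m. (lam * b) ^ j * sin (2 * pi * (real b ^ j * x)))) has_real_derivative
      - (2 * pi) * (\<Sum>j<m. (lam * b) ^ j * (cos (2 * pi * (real b ^ j * x)) * (2 * pi * real b ^ j)))) (at x)"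
    by (auto intro!: derivative_eq_intros simp: mult_ac)
  moreover have "- (2 * pi) * (\<Sum>j<m. (lam * b) ^ j * (cos (2 * pi * (real b ^ j * x)) * (2 * pi * real b ^ j)))
      = partial_deriv2 m x"
    unfolding partial_deriv2_def
    by (simp add: sum_distrib_left power2_eq_square mult_ac power_mult_distrib)
  ultimately show ?thesis
    by (simp add: partial_deriv_def[abs_def])
qed

lemma continuous_partial_deriv2: "continuous_on UNIV (partial_deriv2 m)"
  unfolding partial_deriv2_def by (intro continuous_intros)

lemma abs_partial_deriv_le: "\<bar>partial_deriv m x\<bar> \<le> 4 * pi * (lam * b) ^ m"
proof -
  have "\<bar>\<Sum>j<m. (lam * b) ^ j * sin (2 * pi * (real b ^ j * x))\<bar> \<le> (\<Sum>j<m. (lam * b) ^ j)"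
    using lam_b by (intro order_trans[OF sum_abs] sum_mono) (simp add: abs_mult mult_left_le)
  also have "\<dots> \<le> 2 * (lam * b) ^ m"
    by (rule geometric_sum_le[OF lam_b])
  finally have "2 * pi * \<bar>\<Sum>j<m. (lam * b) ^ j * sin (2 * pi * (real b ^ j * x))\<bar> \<le> 2 * pi * (2 * (lam * b) ^ m)"
    by (intro mult_left_mono) auto
  then show ?thesis by (simp add: partial_deriv_def abs_mult)
qed

lemma abs_partial_deriv2_le: "\<bar>partial_deriv2 m x\<bar> \<le> 8 * pi\<^sup>2 * (lam * b\<^sup>2) ^ m"
proof -
  have q: "3 / 2 \<le> lam * (real b)\<^sup>2"
    using lam_b b mult_mono[of "3 / 2" "lam * real b" 1 "real b"] by (simp add: power2_eq_square mult_ac)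
  have "\<bar>\<Sum>j<m. (lam * b\<^sup>2) ^ j * cos (2 * pi * (real b ^ j * x))\<bar> \<le> (\<Sum>j<m. (lam * b\<^sup>2) ^ j)"
    using q by (intro order_trans[OF sum_abs] sum_mono) (simp add: abs_mult mult_left_le)
  also have "\<dots> \<le> 2 * (lam * b\<^sup>2) ^ m"
    using geometric_sum_le[OF q] by simp
  finally have "(2 * pi)\<^sup>2 * \<bar>\<Sum>j<m. (lam * b\<^sup>2) ^ j * cos (2 * pi * (real b ^ j * x))\<bar> \<le>
      (2 * pi)\<^sup>2 * (2 * (lam * b\<^sup>2) ^ m)"
    by (intro mult_left_mono) auto
  then show ?thesis by (simp add: partial_deriv2_def abs_mult power_mult_distrib)
qed

lemma phase_has_derivative: "(phase m C has_real_derivative phase_deriv m C v) (at v)"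
proof -
  have "((\<lambda>v. (real C + v) / real b ^ m) has_real_derivative 1 / real b ^ m) (at v)"
    using b_pos by (auto intro!: derivative_eq_intros)
  from DERIV_chain2[OF partial_has_derivative this]
  show ?thesis
    by (simp add: phase_def[abs_def] phase_deriv_def)
qed

lemma phase_deriv_has_derivative: "(phase_deriv m C has_real_derivative phase_deriv2 m C v) (at v)"
proof -
  have "((\<lambda>v. (real C + v) / real b ^ m) has_real_derivative 1 / real b ^ m) (at v)"
    using b_pos by (auto intro!: derivative_eq_intros)
  from DERIV_cdivide[OF DERIV_chain2[OF partial_deriv_has_derivative this], where c = "real b ^ m"]
  show ?thesis
    by (simp add: phase_deriv_def[abs_def] phase_deriv2_def power2_eq_square)
qed

lemma continuous_phase:
  "continuous_on UNIV (phase m C)" "continuous_on UNIV (phase_deriv m C)"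
  using phase_has_derivative phase_deriv_has_derivative
  by (meson DERIV_isCont continuous_at_imp_continuous_on)+

lemma continuous_phase_deriv2: "continuous_on UNIV (phase_deriv2 m C)"
  unfolding phase_deriv2_def using b_pos
  by (intro continuous_intros continuous_on_compose2[OF continuous_partial_deriv2]) auto

text \<open>Rescaling a cell to unit length turns (lam * b)^m into lam^m. First derivatives, second
  derivatives and the separation of phases all have this order, so the ratio \<open>M / k\<close> in
  \<open>nonstationary_phase\<close> depends on \<open>b\<close> alone.\<close>

lemma abs_phase_deriv_le: "\<bar>phase_deriv m C v\<bar> \<le> 4 * pi * lam ^ m"
  using abs_partial_deriv_le[of m "(real C + v) / real b ^ m"] b_pos
  by (simp add: phase_deriv_def field_simps power_mult_distrib)

lemma abs_phase_deriv2_le: "\<bar>phase_deriv2 m C v\<bar> \<le> 8 * pi\<^sup>2 * lam ^ m"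
  using abs_partial_deriv2_le[of m "(real C + v) / real b ^ m"] b_pos
  by (simp add: phase_deriv2_def field_simps power_mult_distrib power_mult[symmetric] mult.commute)

text \<open>Periodicity removes \<open>C\<close> from the argument of the tail, so every cell
  carries the same scaled copy of \<open>W\<close> and only the phase depends on the cell. The
  transfer operator and the localization to cells both rest on this.\<close>

lemma W_branch: "W ((real C + v) / real b ^ m) = phase m C v + lam ^ m * W v"
proof -
  have "real b ^ m * ((real C + v) / real b ^ m) = of_int (int C) + v"
    using b_pos by simp
  then show ?thesis
    using W_split[of "(real C + v) / real b ^ m" m] W_shift[of "int C" v] by (simp add: phase_def)
qed

text \<open>The last \<open>p\<close> digits of the first branch are \<open>0\<close>, those of the second are \<open>b - 1\<close>. Modulo the
  period they contribute the angles of \<open>v / b ^ i\<close> and \<open>- (1 - v) / b ^ i\<close>, so the sine differences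
  have the same sign for all \<open>1 \<le> i \<le> p\<close>; the remaining terms form a small geometric tail.\<close>

lemma phase_deriv_separation:
  assumes p: "2 \<le> p" "p \<le> m" "(2 / 3) ^ p \<le> 1 / (4 * real b ^ 4)"
    and v: "v \<in> {0..1}"
  shows "2 * pi / real b ^ 4 * lam ^ m \<le>
    \<bar>phase_deriv m (b ^ p * D) v - phase_deriv m (b ^ p * D' + (b ^ p - 1)) v\<bar>"
proof -
  define q where "q j = (lam * b) ^ j * (sin (2 * pi * (real b ^ j * ((real (b ^ p * D) + v) / real b ^ m)))
     - sin (2 * pi * (real b ^ j * ((real (b ^ p * D' + (b ^ p - 1)) + v) / real b ^ m))))" for j
  define r where "r i = sin (2 * pi * (v / real b ^ i)) + sin (2 * pi * ((1 - v) / real b ^ i))" for i :: nat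
  have q_r: "q j = (lam * b) ^ j * r (m - j)" if j: "m - p \<le> j" "j < m" for j
  proof -
    define i where "i = m - j"
    have i: "i \<le> p" "j + i = m" using j p by (auto simp: i_def)
    have bi: "real b ^ j / real b ^ m = 1 / real b ^ i"
      using b_pos i by (simp add: power_add[symmetric] field_simps flip: i(2))
    have bp: "real b ^ p = real b ^ i * real b ^ (p - i)"
      using i by (simp flip: power_add)
    have "real b ^ j * ((real (b ^ p * D) + v) / real b ^ m) = real b ^ j / real b ^ m * (real b ^ p * D + v)"
      by simp
    also have "\<dots> = v / real b ^ i + of_int (int b ^ (p - i) * D)"
      unfolding bi bp using b_pos by (simp add: field_simps)
    finally have *: "2 * pi * (real b ^ j * ((real (b ^ p * D) + v) / real b ^ m)) =
        2 * pi * (v / real b ^ i) + 2 * pi * of_int (int b ^ (p - i) * D)"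
      by (simp only: distrib_left)
    have "real (b ^ p - 1) = real b ^ p - 1"
      using b by (simp add: of_nat_diff)
    then have "real (b ^ p * D' + (b ^ p - 1)) + v = real b ^ p * (D' + 1) - (1 - v)"
      by (simp only: of_nat_add of_nat_mult of_nat_power) (simp add: algebra_simps)
    then have "real b ^ j * ((real (b ^ p * D' + (b ^ p - 1)) + v) / real b ^ m) =
        real b ^ j / real b ^ m * (real b ^ p * (D' + 1) - (1 - v))"
      by (simp only: times_divide_eq_left times_divide_eq_right)
    also have "\<dots> = - ((1 - v) / real b ^ i) + of_int (int b ^ (p - i) * (D' + 1))"
      unfolding bi bp using b_pos by (simp add: field_simps)
    finally have **: "2 * pi * (real b ^ j * ((real (b ^ p * D' + (b ^ p - 1)) + v) / real b ^ m)) =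
        - (2 * pi * ((1 - v) / real b ^ i)) + 2 * pi * of_int (int b ^ (p - i) * (D' + 1))"
      by (simp only: distrib_left mult_minus_right)
    show ?thesis
      unfolding q_def r_def * ** i_def[symmetric] by (simp only: sin_add cos_int_2pin sin_int_2pin sin_minus) simp
  qed
  have angle: "2 * pi * (x / c) \<le> pi / (d / 2)" if "d \<le> c" "0 < d" "x \<in> {0..1}" for x c d :: real
  proof -
    have "x / c \<le> 1 / d" using that by (intro frac_le) auto
    then have "2 * pi * (x / c) \<le> 2 * pi * (1 / d)" by (intro mult_left_mono) auto
    then show ?thesis by (simp add: mult_ac)
  qed
  have r_nonneg: "0 \<le> r i" if "1 \<le> i" for i
  proof -
    have "2 \<le> real b ^ i"
      using b self_le_power[of "real b" i] that by (simp add: order_trans[of 2 "real b"])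
    then have "2 * pi * (x / real b ^ i) \<le> pi \<and> 0 \<le> 2 * pi * (x / real b ^ i)" if "x \<in> {0..1}" for x
      using angle[of 2 "real b ^ i" x] that \<open>2 \<le> real b ^ i\<close> by auto
    from this[of v] this[of "1 - v"] v show ?thesis
      unfolding r_def by (intro add_nonneg_nonneg sin_ge_zero) auto
  qed
  \<comment> \<open>The lower bound is taken from digit position 2: at position 1 with b = 2 both
    sines vanish at v = 0 and at v = 1, whereas here all angles lie in [0, pi / 2]. The two angles
    have a constant sum, so linear lower bounds for the sines add up to a bound free of
    \<open>v\<close>.\<close>
  have r2: "2 / real b ^ 2 \<le> r 2"
  proof -
    have "2 * 2 \<le> real b ^ 2"
      using b unfolding power2_eq_square by (intro mult_mono) auto
    then have "2 * pi * (x / real b ^ 2) \<le> pi / 2 \<and> 0 \<le> 2 * pi * (x / real b ^ 2)" if "x \<in> {0..1}" for x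
      using angle[of 4 "(real b)\<^sup>2" x] that \<open>2 * 2 \<le> (real b)\<^sup>2\<close> by auto
    from this[of v] this[of "1 - v"] v
    have "2 * pi * (v / real b ^ 2) / 3 + 2 * pi * ((1 - v) / real b ^ 2) / 3 \<le> r 2"
      unfolding r_def by (intro add_mono sin_ge_third) auto
    moreover have "2 * pi * (v / real b ^ 2) / 3 + 2 * pi * ((1 - v) / real b ^ 2) / 3 = (2 * pi / 3) / real b ^ 2"
      using b_pos by (simp add: field_simps)
    moreover have "2 / real b ^ 2 \<le> (2 * pi / 3) / real b ^ 2"
      using pi_gt3 by (intro divide_right_mono) auto
    ultimately show ?thesis by linarith
  qed
  \<comment> \<open>Nothing is known about the leading digits, so each sine difference is only
    bounded below by -2.\<close>
  have low: "- (4 * (lam * b) ^ (m - p)) \<le> (\<Sum>j<m - p. q j)"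
  proof -
    have "- 2 * (lam * b) ^ j \<le> q j" for j
    proof -
      have "(lam * b) ^ j * (- 2) \<le> q j"
        unfolding q_def using lam_b by (intro mult_left_mono) (smt (verit) sin_le_one sin_ge_minus_one, simp)
      then show ?thesis by simp
    qed
    then have "(\<Sum>j<m - p. - 2 * (lam * b) ^ j) \<le> (\<Sum>j<m - p. q j)"
      by (intro sum_mono)
    then show ?thesis
      using geometric_sum_le[OF lam_b, of "m - p"] by (simp add: sum_distrib_left[symmetric] sum_negf)
  qed
  have high: "(lam * b) ^ (m - 2) * (2 / real b ^ 2) \<le> (\<Sum>j\<in>{m - p..<m}. q j)"
  proof -
    have "(lam * b) ^ (m - 2) * (2 / real b ^ 2) \<le> (lam * b) ^ (m - 2) * r 2"
      using lam_b by (intro mult_left_mono r2) simp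
    also have "\<dots> = q (m - 2)"
      using q_r[of "m - 2"] p by simp
    also have "\<dots> \<le> (\<Sum>j\<in>{m - p..<m}. q j)"
      using p lam_b by (intro member_le_sum) (auto simp: q_r intro!: mult_nonneg_nonneg r_nonneg)
    finally show ?thesis .
  qed
  \<comment> \<open>Main term against tail. Two powers of 1 / b come from \<open>r2\<close>, two
    from (lam * b)^2 <= b^2; the condition on \<open>(2 / 3) ^ p\<close> keeps the tail below half
    of the main term.\<close>
  have "2 / real b ^ 4 - 1 / real b ^ 4 \<le> (\<Sum>j<m. q j) / (lam * b) ^ m"
  proof -
    have sp: "(\<Sum>j<m. q j) = (\<Sum>j<m - p. q j) + (\<Sum>j\<in>{m - p..<m}. q j)"
      using p by (simp add: lessThan_atLeast0 sum.atLeastLessThan_concat)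
    have lb: "0 < lam * real b" using lam_b by simp
    have "2 / real b ^ 4 \<le> (lam * b) ^ (m - 2) * (2 / real b ^ 2) / (lam * b) ^ m"
    proof -
      have "(lam * b) ^ m = (lam * b) ^ (m - 2) * (lam * b)\<^sup>2"
        using p by (metis le_add_diff_inverse2 le_trans power_add)
      then have "(lam * b) ^ (m - 2) * (2 / real b ^ 2) / (lam * b) ^ m = 2 / (lam\<^sup>2 * real b ^ 4)"
        using lb by (simp add: power_mult_distrib power2_eq_square power4_eq_xxxx)
      also have "\<dots> \<ge> 2 / real b ^ 4"
        using b_pos lam_pos lam_upper
        by (intro divide_left_mono) (auto simp: mult_le_cancel_right1 power_le_one)
      finally show ?thesis .
    qed
    moreover have "4 * (lam * b) ^ (m - p) / (lam * b) ^ m \<le> 1 / real b ^ 4"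
    proof -
      have "(lam * b) ^ m = (lam * b) ^ (m - p) * (lam * b) ^ p"
        using p by (simp flip: power_add)
      then have "4 * (lam * b) ^ (m - p) / (lam * b) ^ m = 4 * (1 / (lam * b)) ^ p"
        using lam_pos b_pos by (simp add: power_divide)
      also have "\<dots> \<le> 4 * (2 / 3) ^ p"
        using lam_b lb by (intro mult_left_mono power_mono) (auto simp: field_simps)
      also have "\<dots> \<le> 1 / real b ^ 4" using p(3) by simp
      finally show ?thesis .
    qed
    moreover have "(- (4 * (lam * b) ^ (m - p)) + (lam * b) ^ (m - 2) * (2 / real b ^ 2)) / (lam * b) ^ m
        \<le> (\<Sum>j<m. q j) / (lam * b) ^ m"
      unfolding sp using low high lb by (intro divide_right_mono add_mono) auto
    ultimately show ?thesis
      unfolding add_divide_distrib minus_divide_left[symmetric] by linarith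
  qed
  then have Q: "1 / real b ^ 4 \<le> (\<Sum>j<m. q j) / (lam * b) ^ m" by simp
  have "phase_deriv m (b ^ p * D) v - phase_deriv m (b ^ p * D' + (b ^ p - 1)) v =
      - (2 * pi) * (\<Sum>j<m. q j) / real b ^ m"
  proof -
    have "- (2 * pi) * x / c - - (2 * pi) * y / c = - (2 * pi) * (x - y) / c" for x y c :: real
      by (simp add: diff_divide_distrib right_diff_distrib)
    then show ?thesis
      unfolding phase_deriv_def partial_deriv_def q_def right_diff_distrib[of "(lam * b) ^ _"] sum_subtractf
      by blast
  qed
  also have "\<dots> = - (2 * pi * ((\<Sum>j<m. q j) / (lam * b) ^ m) * lam ^ m)"
    using lam_pos by (simp add: power_mult_distrib)
  finally have e: "\<bar>phase_deriv m (b ^ p * D) v - phase_deriv m (b ^ p * D' + (b ^ p - 1)) v\<bar> =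
      \<bar>2 * pi * ((\<Sum>j<m. q j) / (lam * b) ^ m) * lam ^ m\<bar>" by simp
  have "2 * pi * (1 / real b ^ 4) * lam ^ m \<le> 2 * pi * ((\<Sum>j<m. q j) / (lam * b) ^ m) * lam ^ m"
    using Q lam_pos by (intro mult_right_mono mult_left_mono) auto
  then have "2 * pi * (1 / real b ^ 4) * lam ^ m \<le> \<bar>2 * pi * ((\<Sum>j<m. q j) / (lam * b) ^ m) * lam ^ m\<bar>"
    by (rule order_trans[OF _ abs_ge_self])
  then show ?thesis
    unfolding e by (simp only: times_divide_eq_right mult_1_right)
qed

end

section \<open>The transfer operator\<close>

definition energy :: "(real \<Rightarrow> complex) \<Rightarrow> real" where
  "energy \<psi> = integral {0..1} (\<lambda>v. (norm (\<psi> v))\<^sup>2)"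

lemma energy_nonneg: "0 \<le> energy \<psi>"
  \<comment> \<open>The second case uses the default value 0 of the integral of a non-integrable
    function.\<close>
  unfolding energy_def by (cases "(\<lambda>v. (norm (\<psi> v))\<^sup>2) integrable_on {0..1}")
    (auto intro: Henstock_Kurzweil_Integration.integral_nonneg simp: not_integrable_integral)

lemma energy_cells:
  assumes \<psi>: "continuous_on UNIV \<psi>" and B: "0 < B"
  shows "(\<Sum>C<B. energy (\<lambda>v. \<psi> ((real C + v) / real B))) = real B * energy \<psi>"
  using integral_split_cells[OF continuous_on_power[OF continuous_on_norm[OF \<psi>]] B, of 2] B
  by (simp add: energy_def)

text \<open>AM-GM with a free weight, to be tuned to the relative size of the factors: 1 for two
  amplitudes, \<open>B / \<eta>\<close> or \<open>\<eta> / B\<close> for an amplitude and a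
  derivative.\<close>

lemma integral_norm_mult_le:
  assumes "continuous_on UNIV f" "continuous_on UNIV g" and t: "0 < t"
  shows "integral {0..1} (\<lambda>v. norm (f v) * norm (g v)) \<le> (energy f / t + t * energy g) / 2"
proof -
  have am: "x * y \<le> (x\<^sup>2 / t + t * y\<^sup>2) / 2" for x y :: real
  proof -
    have "0 \<le> (x / sqrt t - sqrt t * y)\<^sup>2" by simp
    also have "\<dots> = x\<^sup>2 / t + t * y\<^sup>2 - 2 * x * y"
      using t by (simp add: power2_diff power_divide power_mult_distrib)
    finally show ?thesis by simp
  qed
  have "integral {0..1} (\<lambda>v. norm (f v) * norm (g v)) \<le>
      integral {0..1} (\<lambda>v. ((norm (f v))\<^sup>2 / t + t * (norm (g v))\<^sup>2) / 2)"
    using t am by (intro integral_le continuous_integrable_on_interval continuous_intros assms) auto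
  also have "\<dots> = (energy f / t + t * energy g) / 2"
    unfolding energy_def
    by (intro integral_unique has_integral_divide has_integral_add has_integral_mult_right
        integrable_integral continuous_integrable_on_interval continuous_intros assms)
  finally show ?thesis .
qed

lemma cis_has_vector_derivative:
  assumes "(f has_real_derivative f') (at x)"
  shows "((\<lambda>x. cis (c * f x)) has_vector_derivative \<i> * of_real (c * f') * cis (c * f x)) (at x)"
  unfolding has_vector_derivative_def using assms
  by (auto intro!: derivative_eq_intros simp: has_field_derivative_def scaleR_conv_of_real algebra_simps)

section \<open>Energy estimates for the transfer operator and its derivative\<close>

context weierstrass_parameters
begin

text \<open>A function \<open>\<psi>\<close> and its derivative are carried along as a pair.\<close>

definition transfer :: "real \<Rightarrow> nat \<Rightarrow> (real \<Rightarrow> complex) \<Rightarrow> real \<Rightarrow> complex" where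
  "transfer \<eta> m \<psi> v =
    (\<Sum>C<b ^ m. \<psi> ((real C + v) / real b ^ m) * cis (\<eta> * phase m C v)) / of_real (real b ^ m)"

definition transfer_deriv ::
    "real \<Rightarrow> nat \<Rightarrow> (real \<Rightarrow> complex) \<Rightarrow> (real \<Rightarrow> complex) \<Rightarrow> real \<Rightarrow> complex" where
  "transfer_deriv \<eta> m \<psi> \<psi>' v =
    (\<Sum>C<b ^ m. (\<psi>' ((real C + v) / real b ^ m) / of_real (real b ^ m) +
      \<psi> ((real C + v) / real b ^ m) * (\<i> * of_real (\<eta> * phase_deriv m C v))) * cis (\<eta> * phase m C v))
    / of_real (real b ^ m)"

lemma continuous_branch:
  assumes "continuous_on UNIV f"
  shows "continuous_on UNIV (\<lambda>v. f ((real C + v) / real b ^ m))"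
  using b_pos by (intro continuous_on_compose2[OF assms] continuous_intros) auto

lemma branch_has_derivative:
  fixes \<psi> :: "real \<Rightarrow> complex"
  assumes \<psi>: "\<And>x. (\<psi> has_vector_derivative \<psi>' x) (at x)"
  shows "((\<lambda>v. \<psi> ((real C + v) / real b ^ m)) has_vector_derivative
    \<psi>' ((real C + v) / real b ^ m) / of_real (real b ^ m)) (at v)"
proof -
  have "((\<lambda>v. (real C + v) / real b ^ m) has_vector_derivative 1 / real b ^ m) (at v)"
    unfolding has_real_derivative_iff_has_vector_derivative[symmetric]
    using b_pos by (auto intro!: derivative_eq_intros)
  from vector_diff_chain_at[OF this \<psi>] show ?thesis
    by (simp add: o_def scaleR_conv_of_real divide_inverse mult.commute)
qed

lemma transfer_has_derivative:
  assumes \<psi>: "\<And>x. (\<psi> has_vector_derivative \<psi>' x) (at x)"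
  shows "(transfer \<eta> m \<psi> has_vector_derivative transfer_deriv \<eta> m \<psi> \<psi>' v) (at v)"
proof -
  have "((\<lambda>v. \<psi> ((real C + v) / real b ^ m) * cis (\<eta> * phase m C v)) has_vector_derivative
     (\<psi>' ((real C + v) / real b ^ m) / of_real (real b ^ m) +
      \<psi> ((real C + v) / real b ^ m) * (\<i> * of_real (\<eta> * phase_deriv m C v))) * cis (\<eta> * phase m C v)) (at v)" for C
    using has_vector_derivative_mult[OF branch_has_derivative[OF \<psi>]
        cis_has_vector_derivative[OF phase_has_derivative]]
    by (simp add: algebra_simps)
  then show ?thesis
    unfolding transfer_def[abs_def] transfer_deriv_def
    by (intro has_vector_derivative_divide has_vector_derivative_sum)
qed

lemma continuous_transfer_deriv:
  assumes "continuous_on UNIV \<psi>" "continuous_on UNIV \<psi>'"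
  shows "continuous_on UNIV (transfer_deriv \<eta> m \<psi> \<psi>')"
  unfolding transfer_deriv_def using b_pos
  by (intro continuous_intros continuous_branch assms continuous_phase) auto

lemma continuous_transfer:
  assumes "continuous_on UNIV \<psi>"
  shows "continuous_on UNIV (transfer \<eta> m \<psi>)"
  unfolding transfer_def using b_pos
  by (intro continuous_intros continuous_branch assms continuous_phase) auto

lemma integral_transfer:
  assumes \<psi>: "continuous_on UNIV \<psi>"
  shows "integral {0..1} (\<lambda>u. \<psi> u * cis (\<eta> * W u)) =
    integral {0..1} (\<lambda>v. transfer \<eta> m \<psi> v * cis (\<eta> * lam ^ m * W v))"
proof -
  let ?z = "\<lambda>C v. \<psi> ((real C + v) / real b ^ m) * cis (\<eta> * phase m C v) * cis (\<eta> * lam ^ m * W v)"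
  have "integral {0..1} (\<lambda>u. \<psi> u * cis (\<eta> * W u)) =
     (\<Sum>C<b ^ m. integral {0..1} (\<lambda>v. \<psi> ((real C + v) / real b ^ m) * cis (\<eta> * W ((real C + v) / real b ^ m))))
       /\<^sub>R real b ^ m"
    using integral_split_cells[of "\<lambda>u. \<psi> u * cis (\<eta> * W u)" "b ^ m"] b
    by (simp add: continuous_intros continuous_W \<psi>)
  also have "\<dots> = (\<Sum>C<b ^ m. integral {0..1} (?z C)) /\<^sub>R real b ^ m"
    unfolding W_branch by (simp add: distrib_left mult.assoc flip: cis_mult)
  also have "(\<Sum>C<b ^ m. integral {0..1} (?z C)) = integral {0..1} (\<lambda>v. \<Sum>C<b ^ m. ?z C v)"
    by (subst Henstock_Kurzweil_Integration.integral_sum)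
       (auto intro!: continuous_integrable_on_interval continuous_intros continuous_branch continuous_phase continuous_W \<psi>)
  also have "\<dots> /\<^sub>R real b ^ m = integral {0..1} (\<lambda>v. (\<Sum>C<b ^ m. ?z C v) /\<^sub>R real b ^ m)"
    by simp
  also have "(\<lambda>v. (\<Sum>C<b ^ m. ?z C v) /\<^sub>R real b ^ m) =
      (\<lambda>v. transfer \<eta> m \<psi> v * cis (\<eta> * lam ^ m * W v))"
    unfolding sum_distrib_right[symmetric] transfer_def scaleR_conv_of_real
    by (simp only: divide_inverse of_real_inverse mult_ac)
  finally show ?thesis .
qed

text \<open>The chain rule gains \<open>1 / b ^ m\<close> on \<open>\<psi>'\<close>, while the
  exponential contributes a phase derivative of order \<open>\<eta> * lam ^ m\<close> on
  \<open>\<psi>\<close>. Relative to the new frequency \<open>\<eta> * lam ^ m\<close>, the first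
  part is small and the second is a fixed multiple of the energy.\<close>

lemma energy_transfer_deriv_le:
  assumes \<psi>: "continuous_on UNIV \<psi>" and \<psi>': "continuous_on UNIV \<psi>'"
  shows "energy (transfer_deriv \<eta> m \<psi> \<psi>') \<le>
    2 / (real b ^ m)\<^sup>2 * energy \<psi>' + 2 * (4 * pi * \<eta> * lam ^ m)\<^sup>2 * energy \<psi>"
proof -
  define B where "B = b ^ m"
  have B: "0 < B" "real b ^ m = real B" using b by (auto simp: B_def)
  define K where "K = 2 * (4 * pi * \<eta> * lam ^ m)\<^sup>2"
  define u where "u C v = 2 / (real B)\<^sup>2 * (norm (\<psi>' ((real C + v) / real B)))\<^sup>2 + K * (norm (\<psi> ((real C + v) / real B)))\<^sup>2" for C :: nat and v
  have sq2: "(x + y)\<^sup>2 \<le> 2 * x\<^sup>2 + 2 * y\<^sup>2" for x y :: real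
    using sum_squares_bound[of x y] by (simp add: power2_sum)
  have pt: "(norm (transfer_deriv \<eta> m \<psi> \<psi>' v))\<^sup>2 \<le> (\<Sum>C<B. u C v) / real B" for v
  proof -
    define z where "z C = (\<psi>' ((real C + v) / real B) / of_real (real B) +
      \<psi> ((real C + v) / real B) * (\<i> * of_real (\<eta> * phase_deriv m C v))) * cis (\<eta> * phase m C v)" for C
    have z: "(norm (z C))\<^sup>2 \<le> u C v" for C
    proof -
      have "norm (z C) \<le> norm (\<psi>' ((real C + v) / real B)) / real B +
          norm (\<psi> ((real C + v) / real B)) * (\<bar>\<eta>\<bar> * \<bar>phase_deriv m C v\<bar>)"
        unfolding z_def by (auto simp: norm_mult norm_divide abs_mult intro!: order_trans[OF norm_triangle_ineq])
      also have "\<dots> \<le> norm (\<psi>' ((real C + v) / real B)) / real B +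
          norm (\<psi> ((real C + v) / real B)) * (\<bar>\<eta>\<bar> * (4 * pi * lam ^ m))"
        by (intro add_left_mono mult_left_mono abs_phase_deriv_le) auto
      finally have "(norm (z C))\<^sup>2 \<le> (norm (\<psi>' ((real C + v) / real B)) / real B +
          norm (\<psi> ((real C + v) / real B)) * (\<bar>\<eta>\<bar> * (4 * pi * lam ^ m)))\<^sup>2"
        by (simp add: power_mono)
      also have "\<dots> \<le> 2 * (norm (\<psi>' ((real C + v) / real B)) / real B)\<^sup>2 +
          2 * (norm (\<psi> ((real C + v) / real B)) * (\<bar>\<eta>\<bar> * (4 * pi * lam ^ m)))\<^sup>2"
        using sq2 .
      also have "\<dots> = u C v"
        by (simp add: u_def K_def power_mult_distrib power_divide mult_ac)
      finally show ?thesis .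
    qed
    have "(norm (transfer_deriv \<eta> m \<psi> \<psi>' v))\<^sup>2 = (norm (\<Sum>C<B. z C))\<^sup>2 / (real B)\<^sup>2"
      unfolding transfer_deriv_def B B_def[symmetric] z_def by (simp add: norm_divide power_divide)
    also have "\<dots> \<le> (real B * (\<Sum>C<B. (norm (z C))\<^sup>2)) / (real B)\<^sup>2"
      by (intro divide_right_mono norm_sum_squared_le) auto
    also have "\<dots> = (\<Sum>C<B. (norm (z C))\<^sup>2) / real B"
      using B by (simp add: power2_eq_square)
    also have "\<dots> \<le> (\<Sum>C<B. u C v) / real B"
      by (intro divide_right_mono sum_mono z) auto
    finally show ?thesis .
  qed
  have cont: "continuous_on UNIV (\<lambda>v. \<psi> ((real C + v) / real B))"
    "continuous_on UNIV (\<lambda>v. \<psi>' ((real C + v) / real B))" for C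
    using continuous_branch[OF \<psi>, of C m] continuous_branch[OF \<psi>', of C m] by (simp_all add: B)
  have u: "(u C has_integral
      2 / (real B)\<^sup>2 * energy (\<lambda>v. \<psi>' ((real C + v) / real B)) + K * energy (\<lambda>v. \<psi> ((real C + v) / real B))) {0..1}" for C
    unfolding u_def energy_def
    by (intro has_integral_add has_integral_mult_right integrable_integral
        continuous_integrable_on_interval continuous_intros cont)
  have "energy (transfer_deriv \<eta> m \<psi> \<psi>') \<le> integral {0..1} (\<lambda>v. (\<Sum>C<B. u C v) / real B)"
    unfolding energy_def
  proof (intro integral_le pt)
    show "(\<lambda>v. (norm (transfer_deriv \<eta> m \<psi> \<psi>' v))\<^sup>2) integrable_on {0..1}"
      by (intro continuous_integrable_on_interval continuous_intros continuous_transfer_deriv \<psi> \<psi>')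
    show "(\<lambda>v. (\<Sum>C<B. u C v) / real B) integrable_on {0..1}"
      using u by (intro integrable_on_divide integrable_sum) auto
  qed
  also have "\<dots> = (\<Sum>C<B. 2 / (real B)\<^sup>2 * energy (\<lambda>v. \<psi>' ((real C + v) / real B)) +
      K * energy (\<lambda>v. \<psi> ((real C + v) / real B))) / real B"
    by (intro integral_unique has_integral_divide has_integral_sum u) auto
  also have "\<dots> = (2 / (real B)\<^sup>2 * (real B * energy \<psi>') + K * (real B * energy \<psi>)) / real B"
    unfolding sum.distrib sum_distrib_left[symmetric] energy_cells[OF \<psi> B(1)] energy_cells[OF \<psi>' B(1)] ..
  also have "\<dots> = 2 / (real B)\<^sup>2 * energy \<psi>' + K * energy \<psi>"
    using B by (simp add: add_divide_distrib)
  finally show ?thesis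
    by (simp add: B K_def)
qed

text \<open>Branches are sorted by their last \<open>p\<close> digits. Plain Cauchy-Schwarz inside a
  residue class and \<open>norm_sum_squared_le_except_pair\<close> across the classes give the gain
  \<open>2 / (P * (P - 1))\<close>, at the price of one correlation. That correlation is a sum of
  oscillatory integrals with separated phases; \<open>K\<close> is the constant of
  \<open>nonstationary_phase\<close> for the lower bound \<open>2 * pi / b ^ 4\<close> and the
  second-derivative bound \<open>16 * pi\<^sup>2\<close>, both in units of
  \<open>lam ^ m\<close>.\<close>

lemma energy_transfer_le:
  fixes p m :: nat and P K \<eta> :: real
  defines "P \<equiv> real b ^ p"
  defines "K \<equiv> (3 + 16 * pi\<^sup>2 / (2 * pi / real b ^ 4)) / (2 * pi / real b ^ 4)"
  assumes p: "2 \<le> p" "p \<le> m" "(2 / 3) ^ p \<le> 1 / (4 * real b ^ 4)"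
    and \<psi>: "\<And>x. (\<psi> has_vector_derivative \<psi>' x) (at x)" and \<psi>': "continuous_on UNIV \<psi>'"
    and \<eta>: "0 < \<eta>"
  shows "energy (transfer \<eta> m \<psi>) \<le> (1 - 2 / (P * (P - 1))) * energy \<psi> +
    2 * K / lam ^ m * (energy \<psi> / \<eta> + (energy \<psi> + energy \<psi>' / \<eta>\<^sup>2) / real b ^ m)"
proof -
  define \<kappa> where "\<kappa> = 2 * pi / real b ^ 4"
  have \<kappa>: "0 < \<kappa>" using b_pos by (simp add: \<kappa>_def)
  have K: "K = (3 + 16 * pi\<^sup>2 / \<kappa>) / \<kappa>" by (simp add: K_def \<kappa>_def)
  have K0: "0 < K" unfolding K using \<kappa> by (auto intro!: divide_pos_pos add_pos_nonneg)
  define L where "L = lam ^ m"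
  have L: "0 < L" using lam_pos by (simp add: L_def)
  define B where "B = b ^ m"
  define N where "N = b ^ (m - p)"
  define Q where "Q = b ^ p"
  have B: "0 < B" "real b ^ m = real B" using b by (auto simp: B_def)
  have QN: "B = Q * N" using p by (simp add: B_def N_def Q_def flip: power_add)
  have Q4: "4 \<le> Q"
  proof -
    have "2 ^ 2 \<le> b ^ 2" using b by (intro power_mono) auto
    also have "b ^ 2 \<le> b ^ p" using b p by (intro power_increasing) auto
    finally show ?thesis by (simp add: Q_def)
  qed
  have PQ: "P = real Q" by (simp add: P_def Q_def)
  have P: "4 \<le> P" using Q4 by (simp add: PQ)
  have c\<psi>: "continuous_on UNIV \<psi>"
    using \<psi> by (meson continuous_at_imp_continuous_on has_vector_derivative_continuous)
  define f where "f C v = \<psi> ((real C + v) / real B)" for C :: nat and v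
  define f' where "f' C v = \<psi>' ((real C + v) / real B) / of_real (real B)" for C :: nat and v
  have df: "(f C has_vector_derivative f' C v) (at v)" for C v
    using branch_has_derivative[OF \<psi>, of C m v] by (simp add: f_def[abs_def] f'_def B)
  have cf: "continuous_on UNIV (f C)" for C
    using continuous_branch[OF c\<psi>, of C m] by (simp add: f_def[abs_def] B)
  have cf': "continuous_on UNIV (f' C)" for C
    using continuous_branch[OF \<psi>', of C m] B by (auto simp: f'_def[abs_def] intro!: continuous_intros)
  have ef': "energy (f' C) = energy (\<lambda>v. \<psi>' ((real C + v) / real B)) / (real B)\<^sup>2" for C
    unfolding energy_def f'_def by (simp add: norm_divide power_divide)
  \<comment> \<open>Share of one branch in the error. The derivative \<open>f' C\<close> carries a
    factor 1 / B, so \<open>B / \<eta>\<close> is the weight that balances it against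
    \<open>f C\<close> in \<open>integral_norm_mult_le\<close>.\<close>
  define e where "e C = energy (f C) + \<eta> * energy (f C) / B + B * energy (f' C) / \<eta>" for C
  have e0: "0 \<le> e C" for C
    unfolding e_def using \<eta> by (intro add_nonneg_nonneg divide_nonneg_nonneg mult_nonneg_nonneg energy_nonneg) auto
  have se: "(\<Sum>C<B. e C) = real B * (energy \<psi> + \<eta> / B * (energy \<psi> + energy \<psi>' / \<eta>\<^sup>2))"
  proof -
    have 1: "(\<Sum>C<B. energy (f C)) = real B * energy \<psi>"
      unfolding f_def by (rule energy_cells[OF c\<psi> B(1)])
    have 2: "(\<Sum>C<B. energy (f' C)) = energy \<psi>' / real B"
      unfolding ef' sum_divide_distrib[symmetric] energy_cells[OF \<psi>' B(1)] using B by (simp add: power2_eq_square)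
    have "(\<Sum>C<B. e C) = (\<Sum>C<B. energy (f C)) + \<eta> * (\<Sum>C<B. energy (f C)) / B + B * (\<Sum>C<B. energy (f' C)) / \<eta>"
      unfolding e_def by (simp add: sum.distrib sum_distrib_left sum_divide_distrib)
    also have "\<dots> = real B * (energy \<psi> + \<eta> / B * (energy \<psi> + energy \<psi>' / \<eta>\<^sup>2))"
      unfolding 1 2 using B \<eta> by (simp add: field_simps power2_eq_square)
    finally show ?thesis .
  qed
  define z where "z C v = f C v * cis (\<eta> * phase m C v)" for C v
  define X where "X q v = (\<Sum>D<N. z (Q * D + q) v)" for q v
  define h where "h D D' v = f (Q * D) v * cnj (f (Q * D' + (Q - 1)) v)" for D D' v
  define \<phi> where "\<phi> D D' v = phase m (Q * D) v - phase m (Q * D' + (Q - 1)) v" for D D' v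
  define \<phi>' where "\<phi>' D D' v = phase_deriv m (Q * D) v - phase_deriv m (Q * D' + (Q - 1)) v" for D D' v
  define \<phi>'' where "\<phi>'' D D' v = phase_deriv2 m (Q * D) v - phase_deriv2 m (Q * D' + (Q - 1)) v" for D D' v
  have c\<phi>: "continuous_on UNIV (\<phi> D D')" for D D'
    unfolding \<phi>_def by (intro continuous_intros continuous_phase)
  have cz: "continuous_on UNIV (z C)" for C
    unfolding z_def by (intro continuous_intros continuous_phase cf)
  have cX: "continuous_on UNIV (X q)" for q
    unfolding X_def by (intro continuous_intros cz)
  have cross: "X 0 v * cnj (X (Q - 1) v) = (\<Sum>D<N. \<Sum>D'<N. h D D' v * cis (\<eta> * \<phi> D D' v))" for v
  proof -
    have "cis (\<eta> * phase m C v) * cnj (cis (\<eta> * phase m C' v)) = cis (\<eta> * (phase m C v - phase m C' v))" for C C'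
      by (simp add: cis_cnj cis_mult right_diff_distrib)
    then have "z C v * cnj (z C' v) = f C v * cnj (f C' v) * cis (\<eta> * (phase m C v - phase m C' v))" for C C'
      unfolding z_def by (metis (no_types, lifting) complex_cnj_mult mult.assoc mult.left_commute)
    then show ?thesis
      unfolding X_def cnj_sum sum_product h_def \<phi>_def by simp
  qed
  \<comment> \<open>The separation is the same for all leading digits \<open>D\<close> and
    \<open>D'\<close>, so after this bound the triangle inequality over all pairs is enough.\<close>
  have pair: "norm (integral {0..1} (\<lambda>v. h D D' v * cis (\<eta> * \<phi> D D' v))) \<le>
      K / (2 * \<eta> * L) * (e (Q * D) + e (Q * D' + (Q - 1)))" for D D'
  proof -
    let ?C = "Q * D" and ?C' = "Q * D' + (Q - 1)"
    define h' where "h' v = f ?C v * cnj (f' ?C' v) + f' ?C v * cnj (f ?C' v)" for v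
    have ch: "continuous_on UNIV (h D D')" unfolding h_def by (intro continuous_intros cf)
    have ch': "continuous_on UNIV h'"
      unfolding h'_def by (intro continuous_intros cf cf')
    let ?H = "integral {0..1} (\<lambda>v. norm (h D D' v))" and ?H' = "integral {0..1} (\<lambda>v. norm (h' v))"
    have "norm (integral {0..1} (\<lambda>v. h D D' v * cis (\<eta> * \<phi> D D' v))) \<le>
        ((2 + 16 * pi\<^sup>2 * L / (\<kappa> * L)) * ?H + 3 * ?H') / (\<eta> * (\<kappa> * L))"
    proof (rule nonstationary_phase)
      show "(h D D' has_vector_derivative h' v) (at v)" for v
        unfolding h_def[abs_def] h'_def
        by (intro has_vector_derivative_mult has_vector_derivative_cnj df)
      show "(\<phi> D D' has_real_derivative \<phi>' D D' v) (at v)" for v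
        unfolding \<phi>_def[abs_def] \<phi>'_def by (intro DERIV_diff phase_has_derivative)
      show "(\<phi>' D D' has_real_derivative \<phi>'' D D' v) (at v)" for v
        unfolding \<phi>'_def[abs_def] \<phi>''_def by (intro DERIV_diff phase_deriv_has_derivative)
      show "continuous_on UNIV (\<phi>'' D D')"
        unfolding \<phi>''_def by (intro continuous_intros continuous_phase_deriv2)
      show "\<kappa> * L \<le> \<bar>\<phi>' D D' v\<bar>" if "v \<in> {0..1}" for v
        using phase_deriv_separation[OF p that, of D D'] by (simp add: \<phi>'_def \<kappa>_def L_def Q_def)
      show "\<bar>\<phi>'' D D' v\<bar> \<le> 16 * pi\<^sup>2 * L" for v
        using abs_phase_deriv2_le[of m ?C v] abs_phase_deriv2_le[of m ?C' v] by (simp add: \<phi>''_def L_def)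
    qed (use ch' \<kappa> L \<eta> in auto)
    also have "\<dots> \<le> K / (\<eta> * L) * (?H + ?H')"
    proof -
      have "0 \<le> ?H" "0 \<le> ?H'"
        by (auto intro!: Henstock_Kurzweil_Integration.integral_nonneg continuous_integrable_on_interval continuous_intros ch ch')
      moreover have "0 \<le> 16 * pi\<^sup>2 / \<kappa>" using \<kappa> by simp
      moreover have "(2 + y) * x + 3 * x' \<le> (3 + y) * (x + x')" if "0 \<le> x" "0 \<le> x'" "0 \<le> y" for x x' y :: real
        using that mult_nonneg_nonneg[of y x'] by (simp add: algebra_simps)
      ultimately have "(2 + 16 * pi\<^sup>2 / \<kappa>) * ?H + 3 * ?H' \<le> (3 + 16 * pi\<^sup>2 / \<kappa>) * (?H + ?H')"
        by blast
      then have "((2 + 16 * pi\<^sup>2 / \<kappa>) * ?H + 3 * ?H') / (\<eta> * (\<kappa> * L)) \<le> (3 + 16 * pi\<^sup>2 / \<kappa>) * (?H + ?H') / (\<eta> * (\<kappa> * L))"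
        using \<kappa> L \<eta> by (intro divide_right_mono) auto
      then show ?thesis using L by (simp add: K mult_ac)
    qed
    also have "\<dots> \<le> K / (\<eta> * L) * ((e ?C + e ?C') / 2)"
    proof (intro mult_left_mono)
      have "?H \<le> (energy (f ?C) + energy (f ?C')) / 2"
        using integral_norm_mult_le[OF cf cf, of 1 ?C ?C'] by (simp add: h_def norm_mult)
      moreover have "?H' \<le> (energy (f ?C) / (B / \<eta>) + B / \<eta> * energy (f' ?C')) / 2 +
          (energy (f' ?C) / (\<eta> / B) + \<eta> / B * energy (f ?C')) / 2"
      proof -
        have "?H' \<le> integral {0..1} (\<lambda>v. norm (f ?C v) * norm (f' ?C' v) + norm (f' ?C v) * norm (f ?C' v))"
          unfolding h'_def
          by (intro integral_le continuous_integrable_on_interval continuous_intros cf cf')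
             (metis norm_triangle_ineq norm_mult complex_mod_cnj)
        also have "\<dots> = integral {0..1} (\<lambda>v. norm (f ?C v) * norm (f' ?C' v)) +
            integral {0..1} (\<lambda>v. norm (f' ?C v) * norm (f ?C' v))"
          by (intro Henstock_Kurzweil_Integration.integral_add continuous_integrable_on_interval continuous_intros cf cf')
        also have "\<dots> \<le> (energy (f ?C) / (B / \<eta>) + B / \<eta> * energy (f' ?C')) / 2 +
          (energy (f' ?C) / (\<eta> / B) + \<eta> / B * energy (f ?C')) / 2"
          using B \<eta> by (intro add_mono integral_norm_mult_le cf cf') auto
        finally show ?thesis .
      qed
      ultimately show "?H + ?H' \<le> (e ?C + e ?C') / 2"
        unfolding e_def by (simp add: add_divide_distrib mult_ac)
    qed (use K0 \<eta> L in auto)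
    finally show ?thesis by (simp add: mult_ac)
  qed
  \<comment> \<open>A crude bound of one residue class by all branches. The smallness of the
    correlation comes from the factors 1 / \<eta> and 1 / B.\<close>
  have class_le: "(\<Sum>D<N. e (Q * D + q)) \<le> (\<Sum>C<B. e C)" if "q < Q" for q
    unfolding QN sum_lessThan_mult
    using that by (intro member_le_sum[of q "{..<Q}" "\<lambda>q. \<Sum>D<N. e (Q * D + q)"] sum_nonneg e0) auto
  have icross: "(\<lambda>v. X 0 v * cnj (X (Q - 1) v)) integrable_on {0..1}"
    by (intro continuous_integrable_on_interval continuous_intros cX)
  have "norm (integral {0..1} (\<lambda>v. X 0 v * cnj (X (Q - 1) v))) \<le>
      (\<Sum>D<N. \<Sum>D'<N. norm (integral {0..1} (\<lambda>v. h D D' v * cis (\<eta> * \<phi> D D' v))))"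
  proof -
    have ih: "(\<lambda>v. h D D' v * cis (\<eta> * \<phi> D D' v)) integrable_on {0..1}" for D D'
      unfolding h_def by (intro continuous_integrable_on_interval continuous_intros cf c\<phi>)
    have "integral {0..1} (\<lambda>v. X 0 v * cnj (X (Q - 1) v)) =
        (\<Sum>D<N. \<Sum>D'<N. integral {0..1} (\<lambda>v. h D D' v * cis (\<eta> * \<phi> D D' v)))"
      unfolding cross
      by (intro integral_unique has_integral_sum finite_lessThan integrable_integral ih)
    then show ?thesis
      by (auto intro!: order_trans[OF norm_sum] sum_mono)
  qed
  also have "\<dots> \<le> (\<Sum>D<N. \<Sum>D'<N. K / (2 * \<eta> * L) * (e (Q * D) + e (Q * D' + (Q - 1))))"
    by (intro sum_mono pair)
  also have "\<dots> = K / (2 * \<eta> * L) * (N * ((\<Sum>D<N. e (Q * D + 0)) + (\<Sum>D<N. e (Q * D + (Q - 1)))))"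
    by (simp add: sum_distrib_left[symmetric] sum_divide_distrib[symmetric] sum.distrib distrib_left
        add_divide_distrib mult.left_commute)
  also have "\<dots> \<le> K / (2 * \<eta> * L) * (N * ((\<Sum>C<B. e C) + (\<Sum>C<B. e C)))"
    using K0 \<eta> L Q4 by (intro mult_left_mono add_mono class_le) auto
  finally have cb: "norm (integral {0..1} (\<lambda>v. X 0 v * cnj (X (Q - 1) v))) \<le> K / (\<eta> * L) * N * (\<Sum>C<B. e C)"
    by (simp add: mult_ac)
  define c where "c = P - 2 / (P - 1)"
  have c: "0 \<le> c"
  proof -
    have "2 / (P - 1) \<le> 1" using P by simp
    then show ?thesis unfolding c_def using P by linarith
  qed
  have pt: "(norm (transfer \<eta> m \<psi> v))\<^sup>2 \<le>
      (c * (real N * (\<Sum>C<B. (norm (f C v))\<^sup>2)) + (P + 1) * Re (X 0 v * cnj (X (Q - 1) v))) / (real B)\<^sup>2" for v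
  proof -
    have "(\<Sum>C<B. z C v) = (\<Sum>q<Q. X q v)"
      unfolding QN X_def by (rule sum_lessThan_mult)
    then have "(norm (transfer \<eta> m \<psi> v))\<^sup>2 = (norm (\<Sum>q<Q. X q v))\<^sup>2 / (real B)\<^sup>2"
      by (simp add: transfer_def B B_def[symmetric] z_def f_def norm_divide power_divide)
    also have "\<dots> \<le> (c * (\<Sum>q<Q. (norm (X q v))\<^sup>2) + (P + 1) * Re (X 0 v * cnj (X (Q - 1) v))) / (real B)\<^sup>2"
      unfolding c_def PQ by (intro divide_right_mono norm_sum_squared_le_except_pair Q4) auto
    also have "\<dots> \<le> (c * (real N * (\<Sum>C<B. (norm (f C v))\<^sup>2)) + (P + 1) * Re (X 0 v * cnj (X (Q - 1) v))) / (real B)\<^sup>2"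
    proof (intro divide_right_mono add_right_mono mult_left_mono)
      have "(\<Sum>q<Q. (norm (X q v))\<^sup>2) \<le> (\<Sum>q<Q. real N * (\<Sum>D<N. (norm (z (Q * D + q) v))\<^sup>2))"
        unfolding X_def by (intro sum_mono norm_sum_squared_le)
      also have "\<dots> = real N * (\<Sum>C<B. (norm (f C v))\<^sup>2)"
        unfolding QN sum_lessThan_mult sum_distrib_left by (simp add: z_def norm_mult)
      finally show "(\<Sum>q<Q. (norm (X q v))\<^sup>2) \<le> real N * (\<Sum>C<B. (norm (f C v))\<^sup>2)" .
    qed (use c in auto)
    finally show ?thesis .
  qed
  have "energy (transfer \<eta> m \<psi>) \<le> integral {0..1} (\<lambda>v.
      (c * (real N * (\<Sum>C<B. (norm (f C v))\<^sup>2)) + (P + 1) * Re (X 0 v * cnj (X (Q - 1) v))) / (real B)\<^sup>2)"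
    unfolding energy_def using B
    by (intro integral_le pt continuous_integrable_on_interval continuous_intros continuous_transfer c\<psi> cf cX) auto
  also have "\<dots> = (c * (real N * (\<Sum>C<B. energy (f C))) +
      (P + 1) * Re (integral {0..1} (\<lambda>v. X 0 v * cnj (X (Q - 1) v)))) / (real B)\<^sup>2"
    unfolding energy_def
    by (intro integral_unique has_integral_divide has_integral_add has_integral_mult_right has_integral_sum
        has_integral_Re finite_lessThan integrable_integral icross continuous_integrable_on_interval continuous_intros cf)
  also have "\<dots> \<le> (c * (real N * (\<Sum>C<B. energy (f C))) + (P + 1) * (K / (\<eta> * L) * N * (\<Sum>C<B. e C))) / (real B)\<^sup>2"
    using P order_trans[OF complex_Re_le_cmod cb]
    by (intro divide_right_mono add_left_mono mult_left_mono) auto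
  also have "(\<Sum>C<B. energy (f C)) = real B * energy \<psi>"
    unfolding f_def by (rule energy_cells[OF c\<psi> B(1)])
  also have "(c * (real N * (real B * energy \<psi>)) + (P + 1) * (K / (\<eta> * L) * N * (\<Sum>C<B. e C))) / (real B)\<^sup>2 =
      c / P * energy \<psi> + (P + 1) / P * (K / L * (energy \<psi> / \<eta> + (energy \<psi> + energy \<psi>' / \<eta>\<^sup>2) / B))"
  proof -
    have "real B = P * real N" by (simp add: QN PQ)
    moreover have "0 < real N" using B(1) QN by (cases N) auto
    ultimately show ?thesis
      unfolding se using P \<eta> L by (simp add: field_simps power2_eq_square)
  qed
  also have "\<dots> \<le> c / P * energy \<psi> + 2 * (K / L * (energy \<psi> / \<eta> + (energy \<psi> + energy \<psi>' / \<eta>\<^sup>2) / B))"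
    using P K0 L \<eta> by (intro add_left_mono mult_right_mono mult_nonneg_nonneg add_nonneg_nonneg
        divide_nonneg_nonneg energy_nonneg) (auto simp: field_simps)
  also have "c / P = 1 - 2 / (P * (P - 1))"
    using P by (simp add: c_def diff_divide_distrib mult.commute)
  finally show ?thesis by (simp add: B L_def mult_ac)
qed

end

section \<open>Contraction and decay\<close>

text \<open>Jensen's inequality on the unit interval, read off from the nonnegative integral of (|f|
  - a)^2 with \<open>a\<close> the mean of |f|. This is the trivial bound that ends the
  iteration.\<close>

lemma norm_integral_squared_le_energy:
  assumes f: "continuous_on UNIV f"
  shows "(norm (integral {0..1} f))\<^sup>2 \<le> energy f"
proof -
  define a where "a = integral {0..1} (\<lambda>v. norm (f v))"
  have "norm (integral {0..1} f) \<le> a"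
    unfolding a_def
    by (intro Henstock_Kurzweil_Integration.integral_norm_bound_integral continuous_integrable_on_interval
        continuous_intros f order_refl)
  then have "(norm (integral {0..1} f))\<^sup>2 \<le> a\<^sup>2"
    by (simp add: power_mono)
  also have "a\<^sup>2 \<le> energy f"
  proof -
    have c: "((\<lambda>v. a\<^sup>2) has_integral a\<^sup>2) {0..1::real}"
      using has_integral_const_real[of "a\<^sup>2" 0 1] by simp
    have "((\<lambda>v. (norm (f v))\<^sup>2 - 2 * a * norm (f v) + a\<^sup>2) has_integral
        energy f - 2 * a * a + a\<^sup>2) {0..1}"
      using c unfolding energy_def a_def
      by (intro has_integral_add has_integral_diff has_integral_mult_right integrable_integral
          continuous_integrable_on_interval continuous_intros f)
    moreover have "0 \<le> (norm (f v))\<^sup>2 - 2 * a * norm (f v) + a\<^sup>2" for v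
      using zero_le_power2[of "norm (f v) - a"] by (simp add: power2_diff mult_ac)
    ultimately have "0 \<le> energy f - 2 * a * a + a\<^sup>2"
      by (rule has_integral_nonneg)
    then show ?thesis by (simp add: power2_eq_square)
  qed
  finally show ?thesis .
qed

section \<open>Choice of constants and iteration of the transfer operator\<close>

context weierstrass_parameters
begin

text \<open>\<open>\<delta>\<close> is the gain of \<open>energy_transfer_le\<close>.
  \<open>\<beta>\<close> is chosen so that 32 * pi^2 * \<beta> = \<delta> / 8, which pays for the
  part of the derivative that is not small. \<open>\<eta>\<^sub>0\<close> gives
  \<open>2 * K / (lam ^ m * \<eta>) \<le> \<delta> / 4\<close> for
  \<open>\<eta> \<ge> \<eta>\<^sub>0\<close> once \<open>lam ^ m \<ge> 1 / 2\<close>. The conditions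
  on \<open>m\<close> control the errors with a power of (b * lam)^m >= (3/2)^m in the
  denominator.\<close>

context
  fixes p m :: nat and P K \<delta> \<beta> \<eta>\<^sub>0 :: real
  defines "P \<equiv> real b ^ p"
  defines "K \<equiv> (3 + 16 * pi\<^sup>2 / (2 * pi / real b ^ 4)) / (2 * pi / real b ^ 4)"
  defines "\<delta> \<equiv> 2 / (P * (P - 1))"
  defines "\<beta> \<equiv> \<delta> / (256 * pi\<^sup>2)"
  defines "\<eta>\<^sub>0 \<equiv> 16 * K / \<delta>"
  assumes p: "2 \<le> p" "p \<le> m" "(2 / 3) ^ p \<le> 1 / (4 * real b ^ 4)"
    and m: "2 * K \<le> \<delta> / 8 * (3 / 2) ^ m" "2 * K \<le> \<beta> / 4 * (3 / 2) ^ m" "3 \<le> (3 / 2 :: real) ^ m"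
    and lam_m: "1 / 2 \<le> lam ^ m"
begin

lemma P_ge_4: "4 \<le> P"
proof -
  have "(2::real) ^ 2 \<le> real b ^ 2" using b by (intro power_mono) auto
  also have "real b ^ 2 \<le> real b ^ p" using b p by (intro power_increasing) auto
  finally show ?thesis by (simp add: P_def)
qed

lemma delta_bounds: "0 < \<delta>" "\<delta> \<le> 1"
proof -
  have "4 * 3 \<le> P * (P - 1)" using P_ge_4 by (intro mult_mono) auto
  then show "0 < \<delta>" "\<delta> \<le> 1" unfolding \<delta>_def by (auto simp: divide_le_eq)
qed

lemma constants_pos: "0 < K" "0 < \<beta>" "0 < \<eta>\<^sub>0"
proof -
  show "0 < K" unfolding K_def using b_pos
    by (intro divide_pos_pos add_pos_nonneg divide_nonneg_nonneg) auto
  then show "0 < \<beta>" "0 < \<eta>\<^sub>0" unfolding \<beta>_def \<eta>\<^sub>0_def using delta_bounds by auto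
qed

text \<open>Bookkeeping of the gain \<delta>: the energy term loses \<delta> / 4 + \<delta> / 8 to
  the correlation and \<delta> / 8 to the derivative, which leaves \<delta> / 2. The derivative term
  retains \<beta> / 4 twice, and 1/2 <= 1 - \<delta> / 2.\<close>

lemma energy_step:
  assumes \<psi>: "\<And>x. (\<psi> has_vector_derivative \<psi>' x) (at x)" and \<psi>': "continuous_on UNIV \<psi>'"
    and \<eta>: "\<eta>\<^sub>0 \<le> \<eta>"
  shows "energy (transfer \<eta> m \<psi>) + \<beta> * (energy (transfer_deriv \<eta> m \<psi> \<psi>') / (\<eta> * lam ^ m)\<^sup>2) \<le>
    (1 - \<delta> / 2) * (energy \<psi> + \<beta> * (energy \<psi>' / \<eta>\<^sup>2))"
proof -
  define L where "L = lam ^ m"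
  define B where "B = real b ^ m"
  define A where "A = energy \<psi>"
  define d where "d = energy \<psi>' / \<eta>\<^sup>2"
  have L: "1 / 2 \<le> L" "0 < L" using lam_m lam_pos by (simp_all add: L_def)
  have B: "0 < B" using b_pos by (simp add: B_def)
  have \<eta>0: "0 < \<eta>" using \<eta> constants_pos by linarith
  have A: "0 \<le> A" and d: "0 \<le> d" by (simp_all add: A_def d_def energy_nonneg)
  have BL: "(3 / 2) ^ m \<le> B * L"
    using power_mono[OF lam_b, of m] by (simp add: B_def L_def power_mult_distrib mult.commute)
  have BL0: "0 < B * L" using B L by simp
  have c\<psi>: "continuous_on UNIV \<psi>"
    using \<psi> by (meson continuous_at_imp_continuous_on has_vector_derivative_continuous)
  have E1: "energy (transfer \<eta> m \<psi>) \<le> (1 - \<delta>) * A + 2 * K / L * (A / \<eta> + (A + d) / B)"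
    using energy_transfer_le[OF p \<psi> \<psi>' \<eta>0] unfolding A_def d_def L_def B_def \<delta>_def P_def K_def .
  have "energy (transfer_deriv \<eta> m \<psi> \<psi>') / (\<eta> * L)\<^sup>2 \<le>
      (2 / B\<^sup>2 * energy \<psi>' + 2 * (4 * pi * \<eta> * L)\<^sup>2 * A) / (\<eta> * L)\<^sup>2"
    using energy_transfer_deriv_le[OF c\<psi> \<psi>', of \<eta> m] unfolding A_def L_def B_def
    by (intro divide_right_mono) auto
  also have "\<dots> = 2 / (B * L)\<^sup>2 * d + 32 * pi\<^sup>2 * A"
    unfolding d_def using \<eta>0 L B by (simp add: field_simps power_mult_distrib)
  also have "\<dots> \<le> 1 / 4 * d + 32 * pi\<^sup>2 * A"
  proof -
    have "3 * 3 \<le> (B * L) * (B * L)" using BL m(3) by (intro mult_mono) auto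
    then have "2 / (B * L)\<^sup>2 \<le> 1 / 4" using BL0 by (simp add: power2_eq_square divide_le_eq)
    then have "2 / (B * L)\<^sup>2 * d \<le> 1 / 4 * d" using d by (rule mult_right_mono)
    then show ?thesis by linarith
  qed
  finally have "\<beta> * (energy (transfer_deriv \<eta> m \<psi> \<psi>') / (\<eta> * L)\<^sup>2) \<le> \<beta> * (1 / 4 * d + 32 * pi\<^sup>2 * A)"
    using constants_pos by (intro mult_left_mono) auto
  also have "\<dots> = \<beta> / 4 * d + \<delta> / 8 * A"
    by (simp add: \<beta>_def field_simps)
  finally have E2: "\<beta> * (energy (transfer_deriv \<eta> m \<psi> \<psi>') / (\<eta> * L)\<^sup>2) \<le> \<beta> / 4 * d + \<delta> / 8 * A" .
  have t1: "2 * K / L / \<eta> \<le> \<delta> / 4"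
  proof -
    have "16 * K \<le> \<eta> * \<delta>" using \<eta> delta_bounds by (simp add: \<eta>\<^sub>0_def divide_le_eq)
    also have "\<dots> \<le> \<eta> * \<delta> * (2 * L)"
      using L \<eta>0 delta_bounds mult_left_mono[of 1 "2 * L" "\<eta> * \<delta>"] by simp
    finally have "8 * K \<le> \<delta> * (\<eta> * L)" by (simp add: mult_ac)
    then show ?thesis using L \<eta>0 by (simp add: field_simps)
  qed
  have t2: "2 * K / L / B \<le> \<delta> / 8" "2 * K / L / B \<le> \<beta> / 4"
  proof -
    have "2 * K \<le> \<delta> / 8 * (B * L)" "2 * K \<le> \<beta> / 4 * (B * L)"
      using m(1,2) BL delta_bounds constants_pos
      by (meson mult_left_mono order_trans divide_nonneg_nonneg less_imp_le zero_le_numeral)+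
    then show "2 * K / L / B \<le> \<delta> / 8" "2 * K / L / B \<le> \<beta> / 4"
      using BL0 L B by (simp_all add: field_simps)
  qed
  have "2 * K / L * (A / \<eta> + (A + d) / B) = 2 * K / L / \<eta> * A + 2 * K / L / B * A + 2 * K / L / B * d"
    using L B \<eta>0 by (simp add: field_simps)
  also have "\<dots> \<le> \<delta> / 4 * A + \<delta> / 8 * A + \<beta> / 4 * d"
    using t1 t2 A d by (intro add_mono mult_right_mono) auto
  finally have "energy (transfer \<eta> m \<psi>) + \<beta> * (energy (transfer_deriv \<eta> m \<psi> \<psi>') / (\<eta> * L)\<^sup>2) \<le>
      (1 - \<delta>) * A + (\<delta> / 4 * A + \<delta> / 8 * A + \<beta> / 4 * d) + (\<beta> / 4 * d + \<delta> / 8 * A)"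
    using E1 E2 by linarith
  also have "\<dots> = (1 - \<delta> / 2) * A + 1 / 2 * (\<beta> * d)"
    by (simp add: field_simps)
  also have "\<dots> \<le> (1 - \<delta> / 2) * A + (1 - \<delta> / 2) * (\<beta> * d)"
    using delta_bounds constants_pos d by (intro add_left_mono mult_right_mono) auto
  finally show ?thesis
    by (simp add: A_def d_def L_def distrib_left)
qed

text \<open>A transfer step multiplies the factor \<open>(\<eta>\<^sub>0 / \<eta>) ^ 4\<close> by
  lam^(-4 m) and the squared norm by at most 1 - \<delta> / 2; by \<open>lam4\<close> the product
  does not grow, so the bound passes back through the step. Once the frequency is at most
  \<open>\<eta>\<^sub>0\<close> that factor is at least 1 and the trivial bound suffices.\<close>

lemma oscillatory_integral_decay:
  assumes lam4: "1 - \<delta> / 2 \<le> (lam ^ m) ^ 4"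
    and \<psi>: "\<And>x. (\<psi> has_vector_derivative \<psi>' x) (at x)" and \<psi>': "continuous_on UNIV \<psi>'"
    and \<eta>: "0 < \<eta>"
  shows "(norm (integral {0..1} (\<lambda>u. \<psi> u * cis (\<eta> * W u))))\<^sup>2 \<le>
    (energy \<psi> + \<beta> * (energy \<psi>' / \<eta>\<^sup>2)) * (\<eta>\<^sub>0 / \<eta>) ^ 4"
proof -
  have L: "0 < lam ^ m" using lam_pos by simp
  have L1: "lam ^ m < 1" using lam_pos lam_upper p by (intro power_less_one_iff[THEN iffD2]) auto
  have small: "(norm (integral {0..1} (\<lambda>u. \<psi> u * cis (\<eta> * W u))))\<^sup>2 \<le>
      (energy \<psi> + \<beta> * (energy \<psi>' / \<eta>\<^sup>2)) * (\<eta>\<^sub>0 / \<eta>) ^ 4"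
    if "\<eta> \<le> \<eta>\<^sub>0" "0 < \<eta>" "\<And>x. (\<psi> has_vector_derivative \<psi>' x) (at x)"
    for \<psi> \<psi>' :: "real \<Rightarrow> complex" and \<eta>
  proof -
    have c\<psi>: "continuous_on UNIV \<psi>"
      using that by (meson continuous_at_imp_continuous_on has_vector_derivative_continuous)
    have "(norm (integral {0..1} (\<lambda>u. \<psi> u * cis (\<eta> * W u))))\<^sup>2 \<le> energy (\<lambda>u. \<psi> u * cis (\<eta> * W u))"
      by (intro norm_integral_squared_le_energy continuous_intros c\<psi> continuous_W)
    also have "\<dots> = energy \<psi>"
      by (simp add: energy_def norm_mult)
    also have "\<dots> \<le> energy \<psi> + \<beta> * (energy \<psi>' / \<eta>\<^sup>2)"
      using constants_pos energy_nonneg[of \<psi>'] by simp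
    also have "\<dots> \<le> (energy \<psi> + \<beta> * (energy \<psi>' / \<eta>\<^sup>2)) * (\<eta>\<^sub>0 / \<eta>) ^ 4"
    proof -
      have "1 \<le> (\<eta>\<^sub>0 / \<eta>) ^ 4" using that by (intro one_le_power) simp
      moreover have "0 \<le> energy \<psi> + \<beta> * (energy \<psi>' / \<eta>\<^sup>2)"
        using constants_pos energy_nonneg by (intro add_nonneg_nonneg mult_nonneg_nonneg) auto
      ultimately show ?thesis by (simp add: mult_le_cancel_left1)
    qed
    finally show ?thesis .
  qed
  \<comment> \<open>Induction on a number of steps bringing the frequency down to
    \<open>\<eta>\<^sub>0\<close>; amplitude, derivative and frequency all change in a step, so all
    are generalized.\<close>
  have main: "(norm (integral {0..1} (\<lambda>u. \<psi> u * cis (\<eta> * W u))))\<^sup>2 \<le>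
      (energy \<psi> + \<beta> * (energy \<psi>' / \<eta>\<^sup>2)) * (\<eta>\<^sub>0 / \<eta>) ^ 4"
    if "\<eta> * (lam ^ m) ^ k \<le> \<eta>\<^sub>0" "0 < \<eta>" "\<And>x. (\<psi> has_vector_derivative \<psi>' x) (at x)"
      "continuous_on UNIV \<psi>'" for k and \<psi> \<psi>' :: "real \<Rightarrow> complex" and \<eta>
    using that
  proof (induction k arbitrary: \<psi> \<psi>' \<eta>)
    case 0
    then show ?case by (intro small) auto
  next
    case (Suc k)
    show ?case
    proof (cases "\<eta> \<le> \<eta>\<^sub>0")
      case True
      then show ?thesis using Suc.prems by (intro small) auto
    next
      case False
      have c\<psi>: "continuous_on UNIV \<psi>"
        using Suc.prems by (meson continuous_at_imp_continuous_on has_vector_derivative_continuous)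
      let ?E = "energy \<psi> + \<beta> * (energy \<psi>' / \<eta>\<^sup>2)"
      have E: "0 \<le> ?E"
        using constants_pos energy_nonneg by (intro add_nonneg_nonneg mult_nonneg_nonneg) auto
      have "(norm (integral {0..1} (\<lambda>u. \<psi> u * cis (\<eta> * W u))))\<^sup>2 =
          (norm (integral {0..1} (\<lambda>v. transfer \<eta> m \<psi> v * cis (\<eta> * lam ^ m * W v))))\<^sup>2"
        by (subst integral_transfer[OF c\<psi>, of \<eta> m]) simp
      also have "\<dots> \<le> (energy (transfer \<eta> m \<psi>) + \<beta> * (energy (transfer_deriv \<eta> m \<psi> \<psi>') / (\<eta> * lam ^ m)\<^sup>2))
          * (\<eta>\<^sub>0 / (\<eta> * lam ^ m)) ^ 4"
      proof (rule Suc.IH)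
        show "\<eta> * lam ^ m * (lam ^ m) ^ k \<le> \<eta>\<^sub>0" using Suc.prems(1) by (simp add: mult_ac)
        show "0 < \<eta> * lam ^ m" using Suc.prems(2) L by simp
        show "(transfer \<eta> m \<psi> has_vector_derivative transfer_deriv \<eta> m \<psi> \<psi>' x) (at x)" for x
          by (intro transfer_has_derivative Suc.prems)
        show "continuous_on UNIV (transfer_deriv \<eta> m \<psi> \<psi>')"
          by (intro continuous_transfer_deriv c\<psi> Suc.prems)
      qed
      also have "\<dots> \<le> ((1 - \<delta> / 2) * ?E) * (\<eta>\<^sub>0 / (\<eta> * lam ^ m)) ^ 4"
        using False Suc.prems by (intro mult_right_mono energy_step) auto
      also have "\<dots> \<le> ((lam ^ m) ^ 4 * ?E) * (\<eta>\<^sub>0 / (\<eta> * lam ^ m)) ^ 4"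
        by (intro mult_right_mono lam4 E) auto
      also have "\<dots> = ?E * (\<eta>\<^sub>0 / \<eta>) ^ 4"
      proof -
        have gen: "x ^ 4 * e * (y / (z * x)) ^ 4 = e * (y / z) ^ 4" if "x \<noteq> 0" for x e y z :: real
          using that by (simp add: power_divide power_mult_distrib)
        show ?thesis by (rule gen) (use L in linarith)
      qed
      finally show ?thesis .
    qed
  qed
  obtain k where "(lam ^ m) ^ k < \<eta>\<^sub>0 / \<eta>"
    using real_arch_pow_inv[OF _ L1, of "\<eta>\<^sub>0 / \<eta>"] constants_pos \<eta> by auto
  then have "\<eta> * (lam ^ m) ^ k \<le> \<eta>\<^sub>0" using \<eta> by (simp add: field_simps)
  then show ?thesis using main \<eta> \<psi> \<psi>' by blast
qed

end

end

text \<open>The norm is squared, so the integral itself is of order \<eta>^(-2) as long as energy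
  \<psi>' / \<eta>^2 stays bounded. One pair \<open>\<beta>\<close>, \<open>c\<close> serves all
  amplitudes, because the later application inserts amplitudes that depend on the cell and on the
  frequency.\<close>

definition oscillatory_decay :: "nat \<Rightarrow> real \<Rightarrow> real \<Rightarrow> real \<Rightarrow> bool" where
  "oscillatory_decay b lam \<beta> c \<longleftrightarrow> (\<forall>\<psi> \<psi>' \<eta>. (\<forall>x. (\<psi> has_vector_derivative \<psi>' x) (at x)) \<longrightarrow>
    continuous_on UNIV \<psi>' \<longrightarrow> 0 < \<eta> \<longrightarrow>
    (norm (integral {0..1} (\<lambda>u. \<psi> u * cis (\<eta> * weierstrass_fun (\<lambda>u. cos (2 * pi * u)) lam b u))))\<^sup>2 \<le>
      (energy \<psi> + \<beta> * (energy \<psi>' / \<eta>\<^sup>2)) * (c / \<eta>) ^ 4)"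

text \<open>The order of choices matters. First \<open>p\<close> makes the tail in
  \<open>phase_deriv_separation\<close> harmless and fixes \<open>P\<close>,
  \<open>\<delta>\<close>, \<open>\<beta>\<close>; then \<open>m\<close> makes
  \<open>(3 / 2) ^ m\<close> large against \<open>K\<close>; \<open>lam_b\<close> comes last, from
  \<open>m\<close> and \<open>\<delta>\<close>. No earlier choice involves
  \<open>lam\<close>.\<close>

lemma oscillatory_decay_near_one:
  fixes b :: nat
  assumes b: "2 \<le> b"
  shows "\<exists>lam_b<1. \<forall>lam. lam_b < lam \<longrightarrow> lam < 1 \<longrightarrow>
    3 / 4 \<le> lam \<and> (\<exists>\<beta>>0. \<exists>c>0. oscillatory_decay b lam \<beta> c)"
proof -
  obtain p0 where p0: "(2 / 3) ^ p0 < 1 / (4 * real b ^ 4)"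
    using real_arch_pow_inv[of "1 / (4 * real b ^ 4)" "2 / 3"] b by auto
  define p where "p = max 2 p0"
  have "p0 \<le> p" by (simp add: p_def)
  then have "(2 / 3 :: real) ^ p \<le> (2 / 3) ^ p0" by (intro power_decreasing) auto
  with p0 have "(2 / 3) ^ p \<le> 1 / (4 * real b ^ 4)" by linarith
  moreover have "2 \<le> p" by (simp add: p_def)
  ultimately have p: "2 \<le> p" "(2 / 3) ^ p \<le> 1 / (4 * real b ^ 4)" by blast+
  define P where "P = real b ^ p"
  define K where "K = (3 + 16 * pi\<^sup>2 / (2 * pi / real b ^ 4)) / (2 * pi / real b ^ 4)"
  define \<delta> where "\<delta> = 2 / (P * (P - 1))"
  define \<beta> where "\<beta> = \<delta> / (256 * pi\<^sup>2)"
  have "(2::real) ^ 2 \<le> real b ^ 2" using b by (intro power_mono) auto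
  also have "real b ^ 2 \<le> P" using b p unfolding P_def by (intro power_increasing) auto
  finally have P: "4 \<le> P" by simp
  have "4 * 3 \<le> P * (P - 1)" using P by (intro mult_mono) auto
  then have \<delta>: "0 < \<delta>" "\<delta> \<le> 1" unfolding \<delta>_def by (auto simp: divide_le_eq)
  then have \<beta>: "0 < \<beta>" by (simp add: \<beta>_def)
  obtain m0 where m0: "max 3 (max (16 * K / \<delta>) (8 * K / \<beta>)) < (3 / 2 :: real) ^ m0"
    using real_arch_pow[of "3 / 2 :: real" "max 3 (max (16 * K / \<delta>) (8 * K / \<beta>))"]
    by (auto simp del: max_less_iff_conj)
  define m where "m = max p m0"
  have "(3 / 2 :: real) ^ m0 \<le> (3 / 2) ^ m" by (intro power_increasing) (auto simp: m_def)
  moreover have "3 < (3 / 2 :: real) ^ m0" "16 * K / \<delta> < (3 / 2 :: real) ^ m0" "8 * K / \<beta> < (3 / 2 :: real) ^ m0"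
    using m0 by simp_all
  ultimately have "3 \<le> (3 / 2 :: real) ^ m" "16 * K / \<delta> \<le> (3 / 2 :: real) ^ m" "8 * K / \<beta> \<le> (3 / 2 :: real) ^ m"
    by linarith+
  then have m: "2 * K \<le> \<delta> / 8 * (3 / 2) ^ m" "2 * K \<le> \<beta> / 4 * (3 / 2) ^ m" "3 \<le> (3 / 2 :: real) ^ m"
    using \<delta> \<beta> by (auto simp: divide_le_eq mult.commute)
  have pm: "p \<le> m" by (simp add: m_def)
  define \<theta> where "\<theta> = 1 - \<delta> / 2"
  have \<theta>: "1 / 2 \<le> \<theta>" "\<theta> < 1" using \<delta> by (simp_all add: \<theta>_def)
  \<comment> \<open>The root encodes \<open>\<theta> \<le> lam ^ (4 * m)\<close>; as
    \<open>\<theta> \<ge> 1 / 2\<close>, this also yields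
    \<open>lam ^ m \<ge> 1 / 2\<close>.\<close>
  define lam_b where "lam_b = max (3 / 4) (root (m * 4) \<theta>)"
  have m4: "0 < m * 4" using pm p by simp
  have "lam_b < 1"
    using \<theta> m4 by (auto simp: lam_b_def real_root_lt_1_iff)
  moreover have "3 / 4 \<le> lam \<and> (\<exists>\<beta>>0. \<exists>c>0. oscillatory_decay b lam \<beta> c)" if lam: "lam_b < lam" "lam < 1" for lam
  proof -
    have l: "3 / 4 \<le> lam" "root (m * 4) \<theta> \<le> lam" using lam by (auto simp: lam_b_def)
    interpret weierstrass_parameters b lam
      using b l lam by unfold_locales auto
    have "\<theta> = root (m * 4) \<theta> ^ (m * 4)"
      using \<theta> m4 by (intro real_root_pow_pos2[symmetric]) auto
    also have "\<dots> \<le> lam ^ (m * 4)"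
      using l \<theta> by (intro power_mono) (auto intro: real_root_ge_zero)
    finally have l4: "\<theta> \<le> (lam ^ m) ^ 4" by (simp add: power_mult)
    have "(lam ^ m) ^ 4 \<le> (lam ^ m) ^ 1"
      using lam lam_pos by (intro power_decreasing) (auto intro: power_le_one)
    then have lm: "1 / 2 \<le> lam ^ m" using l4 \<theta> by simp
    have K: "0 < K" unfolding K_def using b_pos
      by (intro divide_pos_pos add_pos_nonneg divide_nonneg_nonneg) auto
    have "oscillatory_decay b lam \<beta> (16 * K / \<delta>)"
      unfolding oscillatory_decay_def
      using oscillatory_integral_decay[OF p(1) pm p(2), folded P_def K_def, folded \<delta>_def, folded \<beta>_def,
          OF m lm l4[unfolded \<theta>_def]] by blast
    then show ?thesis using l \<beta> \<delta> K by (intro conjI exI[of _ \<beta>] exI[of _ "16 * K / \<delta>"]) auto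
  qed
  ultimately show ?thesis by blast
qed

section \<open>Occupation measures\<close>

lemma sum_inverse_squares_le: "(\<Sum>k<n. 1 / (real (Suc k))\<^sup>2) \<le> 2 - 1 / real n"
proof (induction n)
  case (Suc n)
  \<comment> \<open>The telescoping step divides by \<open>n\<close>. At \<open>n = 0\<close> the
    convention 1 / 0 = 0 makes the induction hypothesis too weak, so the first term is checked
    directly.\<close>
  show ?case
  proof (cases "n = 0")
    case False
    have "1 / (real (Suc n))\<^sup>2 \<le> 1 / (real n * real (Suc n))"
      using False by (intro divide_left_mono) (auto simp: power2_eq_square)
    also have "\<dots> = 1 / real n - 1 / real (Suc n)"
      using False by (simp add: field_simps)
    finally show ?thesis using Suc.IH by simp
  qed simp
qed simp

text \<open>The trigonometric polynomial \<open>\<Sum>j<J. cis (j * t)\<close> is at least \<open>J / 2\<close> in norm for \<open>\<bar>t\<bar> \<le> 1 / J\<close>;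
  its square mean over \<open>F x - y\<close> involves only the integer frequencies below \<open>J\<close>.\<close>

lemma measure_near_le:
  fixes F :: "real \<Rightarrow> real"
  assumes F: "continuous_on UNIV F" and "a \<le> c" and K: "0 \<le> K"
    and decay: "\<And>j::nat. 1 \<le> j \<Longrightarrow> norm (integral {a..c} (\<lambda>x. cis (real j * F x))) \<le> (c - a) * K / (real j)\<^sup>2"
    and \<rho>: "0 < \<rho>"
  shows "{x\<in>{a..c}. \<bar>F x - y\<bar> \<le> \<rho>} \<in> lmeasurable"
    and "measure lebesgue {x\<in>{a..c}. \<bar>F x - y\<bar> \<le> \<rho>} \<le> 8 * (1 + 4 * K) * (c - a) * \<rho>"
proof -
  define E where "E = {x\<in>{a..c}. \<bar>F x - y\<bar> \<le> \<rho>}"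
  have "closed {x. \<bar>F x - y\<bar> \<le> \<rho>}"
    by (intro closed_Collect_le continuous_intros F)
  then have "compact ({a..c} \<inter> {x. \<bar>F x - y\<bar> \<le> \<rho>})"
    by (intro compact_Int_closed) auto
  moreover have "E = {a..c} \<inter> {x. \<bar>F x - y\<bar> \<le> \<rho>}"
    by (auto simp: E_def)
  ultimately have E: "E \<in> lmeasurable"
    by (simp add: lmeasurable_compact)
  then show "{x\<in>{a..c}. \<bar>F x - y\<bar> \<le> \<rho>} \<in> lmeasurable" by (simp add: E_def)
  have "measure lebesgue E \<le> 8 * (1 + 4 * K) * (c - a) * \<rho>"
  proof (cases "1 < \<rho>")
    case True
    have "measure lebesgue E \<le> measure lebesgue {a..c}"
      by (intro measure_mono_fmeasurable) (use E in \<open>auto simp: E_def\<close>)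
    also have "\<dots> = (c - a) * 1" using assms(2) by simp
    also have "\<dots> \<le> (c - a) * (8 * (1 + 4 * K) * \<rho>)"
    proof -
      have "1 * 1 \<le> (8 * (1 + 4 * K)) * \<rho>" using True K by (intro mult_mono) auto
      then show ?thesis using assms(2) by (intro mult_left_mono) auto
    qed
    finally show ?thesis by (simp add: mult_ac)
  next
    case False
    \<comment> \<open>Largest \<open>J\<close> with \<open>J * \<rho> \<le> 1\<close>: on
      \<open>E\<close> all angles of the exponential sum stay in [-1, 1], and
      \<open>2 * J * \<rho> \<ge> 1\<close> finally trades 1 / J for 2 * \<rho>. It is at least 1,
      since \<rho> > 1 has been settled by the length of the interval.\<close>
    define J where "J = nat \<lfloor>1 / \<rho>\<rfloor>"
    have "1 \<le> 1 / \<rho>" using False \<rho> by simp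
    then have J: "1 \<le> J" "real J \<le> 1 / \<rho>" "1 / \<rho> < real J + 1"
      unfolding J_def by linarith+
    have J\<rho>: "real J * \<rho> \<le> 1" using J(2) \<rho> by (simp add: field_simps)
    have J2: "1 \<le> 2 * real J * \<rho>"
    proof -
      have "1 / \<rho> \<le> 2 * real J" using J by linarith
      then show ?thesis using \<rho> by (simp add: field_simps)
    qed
    \<comment> \<open>Bound for the integral at frequency difference \<open>k\<close>, relative to
      the length. The diagonal value is set separately, as \<open>K / 0\<close> would be 0.\<close>
    define w where "w k = (if k = 0 then 1 else K / (real k)\<^sup>2)" for k :: nat
    define S where "S x = (\<Sum>j<J. cis (real j * (F x - y)))" for x
    have diag: "norm (integral {a..c} (\<lambda>x. cis (real j * (F x - y)))) \<le> (c - a) * w j" for j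
    proof (cases "j = 0")
      case False
      have "integral {a..c} (\<lambda>x. cis (real j * (F x - y))) =
          integral {a..c} (\<lambda>x. cis (- (real j * y)) * cis (real j * F x))"
        by (simp add: cis_mult right_diff_distrib)
      also have "\<dots> = cis (- (real j * y)) * integral {a..c} (\<lambda>x. cis (real j * F x))"
        by (rule Henstock_Kurzweil_Integration.integral_mult_right)
      finally show ?thesis using decay[of j] False by (simp add: norm_mult w_def)
    qed (use assms(2) in \<open>simp add: w_def\<close>)
    have pair: "Re (integral {a..c} (\<lambda>x. cis (real j * (F x - y)) * cnj (cis (real l * (F x - y))))) \<le>
        (c - a) * w (if l < j then j - l else l - j)" for j l
    proof -
      define I where "I = integral {a..c} (\<lambda>x. cis (real j * (F x - y)) * cnj (cis (real l * (F x - y))))"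
      have I: "I = integral {a..c} (\<lambda>x. cis ((real j - real l) * (F x - y)))"
        unfolding I_def by (simp add: cis_cnj cis_mult left_diff_distrib)
      have "norm I \<le> (c - a) * w (if l < j then j - l else l - j)"
      proof (cases "l < j")
        case True
        then show ?thesis using diag[of "j - l"] by (simp add: I of_nat_diff)
      next
        case False
        have "cnj I = integral {a..c} (\<lambda>x. cis (real (l - j) * (F x - y)))"
          unfolding I integral_cnj using False by (simp add: cis_cnj of_nat_diff algebra_simps)
        then show ?thesis using diag[of "l - j"] False by (metis complex_mod_cnj)
      qed
      then show ?thesis using complex_Re_le_cmod[of I] by (simp add: I_def)
    qed
    have tail: "(\<Sum>k<n. w (Suc k)) \<le> 2 * K" for n
    proof -
      have "(\<Sum>k<n. w (Suc k)) = K * (\<Sum>k<n. 1 / (real (Suc k))\<^sup>2)"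
        by (simp add: w_def sum_distrib_left)
      also have "\<dots> \<le> K * 2"
        using K sum_inverse_squares_le[of n] by (intro mult_left_mono) (auto intro: order_trans)
      finally show ?thesis by simp
    qed
    \<comment> \<open>Row sums as in Schur's test: 1 from the diagonal and at most 2 * K from each
      side. Being free of \<open>J\<close>, the bound makes the square mean linear in
      \<open>J\<close>, against the quadratic lower bound on \<open>E\<close>.\<close>
    have row: "(\<Sum>l<J. w (if l < j then j - l else l - j)) \<le> 1 + 4 * K" if "j < J" for j
    proof -
      have "(\<Sum>l<J. w (if l < j then j - l else l - j)) =
          (\<Sum>l<j. w (if l < j then j - l else l - j)) + (\<Sum>l\<in>{j..<J}. w (if l < j then j - l else l - j))"
        unfolding lessThan_atLeast0 using that by (intro sum.atLeastLessThan_concat[symmetric]) auto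
      also have "(\<Sum>l<j. w (if l < j then j - l else l - j)) = (\<Sum>l<j. w (Suc (j - Suc l)))"
        by (intro sum.cong) (auto simp: Suc_diff_Suc)
      also have "\<dots> = (\<Sum>k<j. w (Suc k))"
        by (rule sum.nat_diff_reindex)
      also have "(\<Sum>l\<in>{j..<J}. w (if l < j then j - l else l - j)) = (\<Sum>k<J - j. w k)"
        using sum.shift_bounds_nat_ivl[of "\<lambda>l. w (if l < j then j - l else l - j)" 0 j "J - j"] that
        by (simp add: lessThan_atLeast0)
      also have "\<dots> = w 0 + (\<Sum>k<J - Suc j. w (Suc k))"
        using that by (metis Suc_diff_Suc sum.lessThan_Suc_shift)
      finally show ?thesis using tail[of j] tail[of "J - Suc j"] by (simp add: w_def)
    qed
    have contS: "continuous_on UNIV S"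
      unfolding S_def by (intro continuous_intros F)
    have sq: "complex_of_real ((norm (S x))\<^sup>2) = (\<Sum>j<J. \<Sum>l<J. cis (real j * (F x - y)) * cnj (cis (real l * (F x - y))))" for x
      unfolding complex_norm_square S_def cnj_sum sum_product ..
    have intS: "integral {a..c} (\<lambda>x. (norm (S x))\<^sup>2) \<le> real J * ((c - a) * (1 + 4 * K))"
    proof -
      have "((\<lambda>x. complex_of_real ((norm (S x))\<^sup>2)) has_integral
         (\<Sum>j<J. \<Sum>l<J. integral {a..c} (\<lambda>x. cis (real j * (F x - y)) * cnj (cis (real l * (F x - y)))))) {a..c}"
        unfolding sq by (intro has_integral_sum finite_lessThan integrable_integral
            continuous_integrable_on_interval continuous_intros F)
      from has_integral_Re[OF this]
      have "integral {a..c} (\<lambda>x. (norm (S x))\<^sup>2) =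
        (\<Sum>j<J. \<Sum>l<J. Re (integral {a..c} (\<lambda>x. cis (real j * (F x - y)) * cnj (cis (real l * (F x - y))))))"
        by (simp only: Re_complex_of_real Re_sum integral_unique)
      also have "\<dots> \<le> (\<Sum>j<J. \<Sum>l<J. (c - a) * w (if l < j then j - l else l - j))"
        by (intro sum_mono pair)
      also have "\<dots> \<le> (\<Sum>j<J. (c - a) * (1 + 4 * K))"
        unfolding sum_distrib_left[symmetric] using assms(2) by (intro sum_mono mult_left_mono row) auto
      finally show ?thesis by simp
    qed
    have low: "(real J)\<^sup>2 / 4 \<le> (norm (S x))\<^sup>2" if "x \<in> E" for x
    proof -
      have "1 / 2 \<le> cos (real j * (F x - y))" if "j < J" for j
      proof -
        have "\<bar>real j * (F x - y)\<bar> \<le> real J * \<rho>"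
          using that \<open>x \<in> E\<close> unfolding abs_mult by (intro mult_mono) (auto simp: E_def)
        then have "\<bar>real j * (F x - y)\<bar> \<le> pi / 3" using J\<rho> pi_gt3 by linarith
        then have "cos (pi / 3) \<le> cos \<bar>real j * (F x - y)\<bar>"
          by (intro cos_monotone_0_pi_le) auto
        then show ?thesis by (simp add: cos_60)
      qed
      then have "(\<Sum>j<J. 1 / 2) \<le> Re (S x)"
        unfolding S_def Re_sum by (intro sum_mono) auto
      then have "real J / 2 \<le> norm (S x)"
        using complex_Re_le_cmod[of "S x"] by simp
      from power_mono[OF this, of 2] show ?thesis by (simp add: power_divide)
    qed
    have "((\<lambda>x. 1::real) has_integral measure lebesgue E) E"
      using E lmeasure_integral lmeasurable_iff_integrable_on has_integral_iff by metis
    moreover have "E \<subseteq> {a..c}" by (auto simp: E_def)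
    ultimately have "((\<lambda>x. if x \<in> E then 1::real else 0) has_integral measure lebesgue E) {a..c}"
      by (simp only: has_integral_restrict)
    then have "((\<lambda>x. (real J)\<^sup>2 / 4 * (if x \<in> E then 1 else 0)) has_integral (real J)\<^sup>2 / 4 * measure lebesgue E) {a..c}"
      by (rule has_integral_mult_right)
    moreover have "((\<lambda>x. (norm (S x))\<^sup>2) has_integral integral {a..c} (\<lambda>x. (norm (S x))\<^sup>2)) {a..c}"
      by (intro integrable_integral continuous_integrable_on_interval continuous_intros contS)
    ultimately have "(real J)\<^sup>2 / 4 * measure lebesgue E \<le> integral {a..c} (\<lambda>x. (norm (S x))\<^sup>2)"
      by (rule has_integral_le) (use low in auto)
    also note intS
    finally have "real J * (real J * measure lebesgue E) \<le> real J * (4 * ((c - a) * (1 + 4 * K)))"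
      by (simp add: power2_eq_square)
    then have m: "real J * measure lebesgue E \<le> 4 * ((c - a) * (1 + 4 * K))"
      using J by simp
    have "measure lebesgue E \<le> (2 * real J * \<rho>) * measure lebesgue E"
      using J2 mult_right_mono[OF J2, of "measure lebesgue E"] by simp
    also have "\<dots> = 2 * \<rho> * (real J * measure lebesgue E)" by simp
    also have "\<dots> \<le> 2 * \<rho> * (4 * ((c - a) * (1 + 4 * K)))"
      using \<rho> m by (intro mult_left_mono) auto
    finally show ?thesis by (simp add: mult_ac)
  qed
  then show "measure lebesgue {x\<in>{a..c}. \<bar>F x - y\<bar> \<le> \<rho>} \<le> 8 * (1 + 4 * K) * (c - a) * \<rho>"
    by (simp add: E_def)
qed

section \<open>Occupation of small squares by the Weierstrass function\<close>

context weierstrass_parameters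
begin

text \<open>On a cell, W / lam^n is the phase divided by lam^n plus \<open>W v\<close>. The
  exponential of the first part is the amplitude; its derivative is at most 4 * pi * j, comparable
  to the frequency \<open>j\<close>, so energy \<psi>' / j^2 is bounded uniformly in the level and
  the cell.\<close>

lemma cell_integral_decay:
  assumes decay: "oscillatory_decay b lam \<beta> c" and \<beta>: "0 < \<beta>" and c: "0 < c" and j: "1 \<le> (j::nat)"
  shows "norm (integral {real A / real b ^ n..(real A + 1) / real b ^ n} (\<lambda>x. cis (real j * (W x / lam ^ n)))) \<le>
    1 / real b ^ n * (sqrt (1 + 16 * pi\<^sup>2 * \<beta>) * c\<^sup>2) / (real j)\<^sup>2"
proof -
  have L: "0 < lam ^ n" using lam_pos by simp
  define \<psi> where "\<psi> v = cis (real j / lam ^ n * phase n A v)" for v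
  define \<psi>' where "\<psi>' v = \<i> * of_real (real j / lam ^ n * phase_deriv n A v) * cis (real j / lam ^ n * phase n A v)" for v
  have d: "(\<psi> has_vector_derivative \<psi>' v) (at v)" for v
    unfolding \<psi>_def[abs_def] \<psi>'_def by (rule cis_has_vector_derivative[OF phase_has_derivative])
  have c\<psi>': "continuous_on UNIV \<psi>'"
    unfolding \<psi>'_def by (intro continuous_intros continuous_phase)
  have e: "energy \<psi> = 1" by (simp add: energy_def \<psi>_def)
  have b': "(norm (\<psi>' v))\<^sup>2 \<le> 16 * pi\<^sup>2 * (real j)\<^sup>2" for v
  proof -
    have "norm (\<psi>' v) = real j * (\<bar>phase_deriv n A v\<bar> / lam ^ n)"
      unfolding \<psi>'_def using L lam_pos by (simp add: norm_mult norm_divide norm_power abs_mult)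
    also have "\<dots> \<le> real j * (4 * pi)"
      using abs_phase_deriv_le[of n A v] L by (intro mult_left_mono) (auto simp: divide_le_eq)
    finally have "(norm (\<psi>' v))\<^sup>2 \<le> (real j * (4 * pi))\<^sup>2" by (intro power_mono) auto
    then show ?thesis by (simp add: power_mult_distrib mult_ac)
  qed
  have e': "energy \<psi>' \<le> 16 * pi\<^sup>2 * (real j)\<^sup>2"
  proof -
    have "energy \<psi>' \<le> integral {0..1::real} (\<lambda>_. 16 * pi\<^sup>2 * (real j)\<^sup>2)"
      unfolding energy_def by (intro integral_le b' continuous_integrable_on_interval continuous_intros c\<psi>')
    then show ?thesis by simp
  qed
  let ?I = "integral {0..1} (\<lambda>v. \<psi> v * cis (real j * W v))"
  have "(norm ?I)\<^sup>2 \<le> (energy \<psi> + \<beta> * (energy \<psi>' / (real j)\<^sup>2)) * (c / real j) ^ 4"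
    using decay d c\<psi>' j unfolding oscillatory_decay_def by auto
  also have "\<dots> \<le> (1 + \<beta> * (16 * pi\<^sup>2)) * (c / real j) ^ 4"
    unfolding e using e' \<beta> j by (intro mult_right_mono add_left_mono mult_left_mono) (auto simp: divide_le_eq)
  also have "\<dots> = (sqrt (1 + 16 * pi\<^sup>2 * \<beta>) * c\<^sup>2 / (real j)\<^sup>2)\<^sup>2"
    using \<beta> by (simp add: power_divide power_mult_distrib mult_ac)
  finally have I: "norm ?I \<le> sqrt (1 + 16 * pi\<^sup>2 * \<beta>) * c\<^sup>2 / (real j)\<^sup>2"
    by (rule power2_le_imp_le) (use \<beta> in auto)
  have "integral {real A / real b ^ n..(real A + 1) / real b ^ n} (\<lambda>x. cis (real j * (W x / lam ^ n))) =
      integral {0..1} (\<lambda>v. cis (real j * (W ((real A + v) / real b ^ n) / lam ^ n))) /\<^sub>R real b ^ n"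
    using b_pos lam_pos by (intro integral_cell continuous_intros continuous_W) auto
  also have "(\<lambda>v. cis (real j * (W ((real A + v) / real b ^ n) / lam ^ n))) = (\<lambda>v. \<psi> v * cis (real j * W v))"
    unfolding W_branch \<psi>_def cis_mult using lam_pos by (simp add: field_simps)
  finally show ?thesis
    using I b_pos by (simp add: divide_inverse mult.assoc mult_left_mono)
qed

text \<open>At the level with b^(-n-1) < d <= b^(-n), the points counted lie in at most three cells.
  Each has length at most b * d and is occupied for a fraction of order d / lam^n, and lam^(-n) is
  at most d to the negative power ln lam / ln b.\<close>

lemma rectangle_measure_le:
  assumes "oscillatory_decay b lam \<beta> c" "0 < \<beta>" "0 < c"
  obtains C where "0 < C" "\<And>d q p. 0 < d \<Longrightarrow> d \<le> 1 \<Longrightarrow> p \<in> {0..<1} \<Longrightarrow>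
    emeasure lebesgue {x\<in>{0..<1}. \<bar>x - p\<bar> \<le> d \<and> \<bar>W x - q\<bar> \<le> d} \<le> ennreal (C * d powr (2 + ln lam / ln b))"
proof -
  define K where "K = sqrt (1 + 16 * pi\<^sup>2 * \<beta>) * c\<^sup>2"
  have K: "0 \<le> K" using assms by (simp add: K_def)
  have "emeasure lebesgue {x\<in>{0..<1}. \<bar>x - p\<bar> \<le> d \<and> \<bar>W x - q\<bar> \<le> d} \<le>
      ennreal (3 * (8 * (1 + 4 * K)) * real b * d powr (2 + ln lam / ln b))"
    if d: "0 < d" "d \<le> 1" and p: "p \<in> {0..<1}" for d q p
  proof -
    have lnb: "0 < ln (real b)" using b by simp
    define n where "n = nat \<lfloor>ln (1 / d) / ln b\<rfloor>"
    have "0 \<le> ln (1 / d) / ln b" using d lnb by simp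
    then have n: "real n \<le> ln (1 / d) / ln b" "ln (1 / d) / ln b < real n + 1"
      unfolding n_def by linarith+
    have n1: "real n * ln b \<le> - ln d" "- ln d < (real n + 1) * ln b"
      using n lnb d by (simp_all add: field_simps ln_div)
    have bn: "real b ^ n = exp (real n * ln b)" "real b ^ Suc n = exp ((real n + 1) * ln b)"
      using b_pos by (simp_all add: exp_of_nat_mult distrib_right exp_add)
    have d1: "d \<le> 1 / real b ^ n"
    proof -
      have "exp (ln d) \<le> exp (- (real n * ln b))" using n1 by simp
      then show ?thesis using d by (simp add: bn exp_minus field_simps)
    qed
    have d2: "1 / real b ^ n \<le> real b * d"
    proof -
      have "exp (- ((real n + 1) * ln b)) \<le> exp (ln d)" using n1 by simp
      then have "1 / real b ^ Suc n \<le> d" using d unfolding bn exp_minus by (simp add: divide_inverse)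
      then show ?thesis using b_pos by (simp add: field_simps)
    qed
    have d3: "1 / lam ^ n \<le> d powr (ln lam / ln b)"
    proof -
      have "ln lam < 0" using lam_pos lam_upper by simp
      moreover have "ln d / ln b \<le> - real n" using n1 lnb by (simp add: field_simps)
      ultimately have "ln lam * (- real n) \<le> ln lam * (ln d / ln b)"
        by (intro mult_left_mono_neg) auto
      moreover have "1 / lam ^ n = exp (ln lam * (- real n))"
        using lam_pos by (simp add: exp_minus exp_of_nat_mult mult.commute[of "ln lam"] divide_inverse)
      ultimately show ?thesis using d by (simp add: powr_def mult_ac)
    qed
    define E where "E A = {x\<in>{real A / real b ^ n..(real A + 1) / real b ^ n}. \<bar>W x / lam ^ n - q / lam ^ n\<bar> \<le> d / lam ^ n}" for A
    have L: "0 < lam ^ n" using lam_pos by simp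
    have dec: "norm (integral {real A / real b ^ n..(real A + 1) / real b ^ n} (\<lambda>x. cis (real j * (W x / lam ^ n)))) \<le>
        ((real A + 1) / real b ^ n - real A / real b ^ n) * K / (real j)\<^sup>2" if "1 \<le> j" for A and j :: nat
      using cell_integral_decay[OF assms that] unfolding K_def by (simp add: diff_divide_distrib[symmetric])
    have E: "E A \<in> lmeasurable" "measure lebesgue (E A) \<le> 8 * (1 + 4 * K) * (1 / real b ^ n) * (d / lam ^ n)" for A
    proof -
      have cW: "continuous_on UNIV (\<lambda>x. W x / lam ^ n)"
        using lam_pos by (intro continuous_intros continuous_W) auto
      have len: "(real A + 1) / real b ^ n - real A / real b ^ n = 1 / real b ^ n" for A
        by (simp add: diff_divide_distrib[symmetric])
      have le: "real A / real b ^ n \<le> (real A + 1) / real b ^ n"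
        using b_pos by (simp add: divide_right_mono)
      show "E A \<in> lmeasurable"
        unfolding E_def using d L by (intro measure_near_le(1)[OF cW le K dec]) auto
      show "measure lebesgue (E A) \<le> 8 * (1 + 4 * K) * (1 / real b ^ n) * (d / lam ^ n)"
        unfolding E_def len[symmetric, of A]
        by (rule measure_near_le(2)[OF cW le K dec]) (use d L in simp_all)
    qed
    \<comment> \<open>As d <= b^(-n), the cell indices of \<open>x\<close> and \<open>p\<close>
      differ by at most 1. Truncated subtraction at \<open>k = 0\<close> leaves only two indices,
      which is compatible with the bound 3.\<close>
    define k where "k = nat \<lfloor>p * real b ^ n\<rfloor>"
    have sub: "{x\<in>{0..<1}. \<bar>x - p\<bar> \<le> d \<and> \<bar>W x - q\<bar> \<le> d} \<subseteq> (\<Union>A\<in>{k - 1..k + 1}. E A)"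
    proof
      fix x assume x: "x \<in> {x\<in>{0..<1}. \<bar>x - p\<bar> \<le> d \<and> \<bar>W x - q\<bar> \<le> d}"
      define A where "A = nat \<lfloor>x * real b ^ n\<rfloor>"
      have "\<bar>x * real b ^ n - p * real b ^ n\<bar> \<le> 1"
      proof -
        have "\<bar>x - p\<bar> \<le> 1 / real b ^ n" using x d1 by auto
        then have "\<bar>x - p\<bar> * real b ^ n \<le> 1" using b_pos by (simp add: field_simps)
        then show ?thesis by (simp add: left_diff_distrib[symmetric] abs_mult)
      qed
      moreover have "0 \<le> x * real b ^ n" "0 \<le> p * real b ^ n" using x p by auto
      ultimately have "A \<in> {k - 1..k + 1}" "real A \<le> x * real b ^ n" "x * real b ^ n \<le> real A + 1"
        unfolding A_def k_def by auto linarith+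
      moreover have "\<bar>W x / lam ^ n - q / lam ^ n\<bar> \<le> d / lam ^ n"
        using x L by (simp add: diff_divide_distrib[symmetric] divide_right_mono)
      ultimately show "x \<in> (\<Union>A\<in>{k - 1..k + 1}. E A)"
        unfolding E_def using b_pos by (auto simp: field_simps intro!: bexI[of _ A])
    qed
    have "emeasure lebesgue {x\<in>{0..<1}. \<bar>x - p\<bar> \<le> d \<and> \<bar>W x - q\<bar> \<le> d} \<le> emeasure lebesgue (\<Union>A\<in>{k - 1..k + 1}. E A)"
      using E by (intro emeasure_mono sub) auto
    also have "\<dots> \<le> (\<Sum>A\<in>{k - 1..k + 1}. emeasure lebesgue (E A))"
      using E by (intro emeasure_subadditive_finite) auto
    also have "\<dots> \<le> (\<Sum>A\<in>{k - 1..k + 1}. ennreal (8 * (1 + 4 * K) * (1 / real b ^ n) * (d / lam ^ n)))"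
      using E by (intro sum_mono) (metis emeasure_eq_measure2 ennreal_leI)
    also have "\<dots> = ennreal (real (card {k - 1..k + 1}) * (8 * (1 + 4 * K) * (1 / real b ^ n) * (d / lam ^ n)))"
    proof -
      have gen: "(\<Sum>A\<in>S. ennreal x) = ennreal (real (card S) * x)" if "0 \<le> x" for x and S :: "nat set"
        using that by (simp add: ennreal_mult ennreal_of_nat_eq_real_of_nat)
      show ?thesis by (rule gen) (use K d L in simp)
    qed
    also have "\<dots> \<le> ennreal (3 * (8 * (1 + 4 * K)) * real b * d powr (2 + ln lam / ln b))"
    proof (rule ennreal_leI)
      have "real (card {k - 1..k + 1}) * (8 * (1 + 4 * K) * (1 / real b ^ n) * (d / lam ^ n)) \<le>
          3 * (8 * (1 + 4 * K) * (real b * d) * (d * d powr (ln lam / ln b)))"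
      proof (intro mult_mono)
        show "d / lam ^ n \<le> d * d powr (ln lam / ln b)"
          using d mult_left_mono[OF d3, of d] by simp
        show "real (card {k - 1..k + 1}) \<le> 3" by simp
      qed (use d2 K d L b_pos in simp_all)
      also have "\<dots> = 3 * (8 * (1 + 4 * K)) * real b * d powr (2 + ln lam / ln b)"
        using d by (simp add: powr_add power2_eq_square mult_ac)
      finally show "real (card {k - 1..k + 1}) * (8 * (1 + 4 * K) * (1 / real b ^ n) * (d / lam ^ n)) \<le>
        3 * (8 * (1 + 4 * K)) * real b * d powr (2 + ln lam / ln b)" .
    qed
    finally show ?thesis .
  qed
  moreover have "0 < 3 * (8 * (1 + 4 * K)) * real b"
    using K b_pos by simp
  ultimately show thesis
    using that by blast
qed

end

section \<open>Hausdorff dimension of the graph\<close>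

text \<open>Powers of a diameter at most 1 decrease in the exponent, so one mass bound with exponent
  \<open>t\<close> serves every smaller \<open>s\<close>. The case distinctions follow the
  conventions at \<open>s = 0\<close> and at diameter 0.\<close>

lemma diam_power_ge_powr:
  assumes "U \<noteq> {}" "bounded U" "diameter U \<le> 1" "0 \<le> s" "s \<le> t"
  shows "ennreal (diameter U powr t) \<le> diam_power s U"
proof -
  have d: "0 \<le> diameter U" using assms by (simp add: diameter_ge_0)
  have "diameter U powr t \<le> (if s = 0 then 1 else diameter U powr s)"
  proof (cases "diameter U = 0")
    case False
    then have "diameter U powr t \<le> diameter U powr s"
      using d assms by (intro powr_mono') auto
    then show ?thesis using False d by auto
  qed auto
  then show ?thesis
    using assms by (auto simp: diam_power_def ennreal_leI split: if_splits simp flip: ennreal_1)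
qed

section \<open>From Hausdorff measures to dimension, and the mass distribution principle\<close>

lemma hausdorff_dim_le:
  assumes "0 \<le> d" "\<And>s. d < s \<Longrightarrow> hausdorff_measure s A = 0"
  shows "hausdorff_dim A \<le> ereal d"
proof (rule ereal_le_epsilon2)
  fix e :: real assume "0 < e"
  then show "hausdorff_dim A \<le> ereal d + ereal e"
    unfolding hausdorff_dim_def using assms by (intro INF_lower2[of "d + e"]) auto
qed

lemma hausdorff_dim_ge:
  assumes "\<And>s. 0 \<le> s \<Longrightarrow> s \<le> d \<Longrightarrow> hausdorff_measure s A \<noteq> 0"
  shows "ereal d \<le> hausdorff_dim A"
  unfolding hausdorff_dim_def using assms by (intro INF_greatest) (force simp: not_le)

lemma hausdorff_measure_eq_0I:
  assumes "\<And>\<delta> e. 0 < \<delta> \<Longrightarrow> 0 < e \<Longrightarrow> \<exists>U\<in>delta_covers \<delta> A. (\<Sum>i. diam_power s (U i)) \<le> ennreal e"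
  shows "hausdorff_measure s A = 0"
proof -
  have "hausdorff_premeasure s \<delta> A \<le> 0" if "0 < \<delta>" for \<delta>
  proof (rule ennreal_le_epsilon)
    fix e :: real assume "0 < e"
    then show "hausdorff_premeasure s \<delta> A \<le> 0 + ennreal e"
      unfolding hausdorff_premeasure_def using assms[OF that] by (auto intro: INF_lower2)
  qed
  then show ?thesis
    unfolding hausdorff_measure_def by (auto intro!: antisym SUP_least)
qed

text \<open>Mass distribution principle for Lebesgue measure lifted to the graph: the projections to
  the x-axis of the graph pieces in a covering cover a set of measure 1, and each piece costs at
  most \<open>C\<close> times its \<open>diam_power\<close>. Coverings at scale 1 are enough, since
  every premeasure is a lower bound of the measure.\<close>

lemma hausdorff_measure_graph_nonzero:
  fixes f :: "real \<Rightarrow> real"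
  assumes f: "continuous_on UNIV f" and C: "0 < C" and s: "0 \<le> s" "s \<le> t" and t: "0 < t"
    and mass: "\<And>d q p. 0 < d \<Longrightarrow> d \<le> 1 \<Longrightarrow> p \<in> {0..<1} \<Longrightarrow>
      emeasure lebesgue {x\<in>{0..<1}. \<bar>x - p\<bar> \<le> d \<and> \<bar>f x - q\<bar> \<le> d} \<le> ennreal (C * d powr t)"
  shows "hausdorff_measure s {(x, f x) | x. x \<in> {0..<1}} \<noteq> 0"
proof -
  let ?G = "{(x, f x) | x. x \<in> {0..<1}}"
  have "ennreal (1 / C) \<le> (\<Sum>i. diam_power s (U i))" if U: "U \<in> delta_covers 1 ?G" for U
  proof -
    have bU: "bounded (U i)" "diameter (U i) \<le> 1" for i
      using U by (auto simp: delta_covers_def)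
    \<comment> \<open>Covering sets are arbitrary and their traces may be non-measurable, so each is
      enlarged to a measurable window around a graph point chosen in it.\<close>
    define E where "E i = (if \<exists>x\<in>{0..<1}. (x, f x) \<in> U i then
        (let p = (SOME p. p \<in> {0..<1} \<and> (p, f p) \<in> U i) in
         {x\<in>{0..<1}. \<bar>x - p\<bar> \<le> diameter (U i) \<and> \<bar>f x - f p\<bar> \<le> diameter (U i)}) else {})" for i
    have E: "E i \<in> sets lebesgue \<and> {x\<in>{0..<1}. (x, f x) \<in> U i} \<subseteq> E i \<and>
        emeasure lebesgue (E i) \<le> ennreal C * diam_power s (U i)" for i
    proof (cases "\<exists>x\<in>{0..<1}. (x, f x) \<in> U i")
      case True
      define p where "p = (SOME p. p \<in> {0..<1} \<and> (p, f p) \<in> U i)"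
      have p: "p \<in> {0..<1}" "(p, f p) \<in> U i"
        using someI_ex[of "\<lambda>p. p \<in> {0..<1} \<and> (p, f p) \<in> U i"] True unfolding p_def by blast+
      define d where "d = diameter (U i)"
      have d: "0 \<le> d" "d \<le> 1" using bU[of i] by (simp_all add: d_def diameter_ge_0)
      have Ei: "E i = {x\<in>{0..<1}. \<bar>x - p\<bar> \<le> d \<and> \<bar>f x - f p\<bar> \<le> d}"
        using True by (simp only: E_def Let_def p_def d_def if_True)
      have "closed {x. \<bar>x - p\<bar> \<le> d \<and> \<bar>f x - f p\<bar> \<le> d}"
        by (intro closed_Collect_conj closed_Collect_le continuous_intros f)
      then have "{0..<1} \<inter> {x. \<bar>x - p\<bar> \<le> d \<and> \<bar>f x - f p\<bar> \<le> d} \<in> sets lebesgue"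
        by (intro sets.Int) auto
      also have "{0..<1} \<inter> {x. \<bar>x - p\<bar> \<le> d \<and> \<bar>f x - f p\<bar> \<le> d} = E i"
        by (auto simp: Ei)
      finally have meas: "E i \<in> sets lebesgue" .
      have sub: "{x\<in>{0..<1}. (x, f x) \<in> U i} \<subseteq> E i"
      proof
        fix x assume x: "x \<in> {x\<in>{0..<1}. (x, f x) \<in> U i}"
        then have "dist (x, f x) (p, f p) \<le> d"
          unfolding d_def using p bU by (intro diameter_bounded_bound) auto
        then show "x \<in> E i"
          using x dist_fst_le[of "(x, f x)" "(p, f p)"] dist_snd_le[of "(x, f x)" "(p, f p)"]
          by (auto simp: Ei dist_real_def)
      qed
      \<comment> \<open>The mass bound requires a positive radius; at diameter 0 the window is at
        most a single point, a null set.\<close>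
      have "emeasure lebesgue (E i) \<le> ennreal (C * d powr t)"
      proof (cases "d = 0")
        case True
        then have "E i \<subseteq> {p}" by (auto simp: Ei)
        then have "emeasure lebesgue (E i) \<le> emeasure lebesgue {p}"
          by (intro emeasure_mono) auto
        then show ?thesis by simp
      next
        case False
        then show ?thesis unfolding Ei using d p by (intro mass) auto
      qed
      also have "\<dots> = ennreal C * ennreal (d powr t)" using C by (simp add: ennreal_mult)
      also have "\<dots> \<le> ennreal C * diam_power s (U i)"
        unfolding d_def using p s bU by (intro mult_left_mono diam_power_ge_powr) auto
      finally show ?thesis using meas sub by blast
    qed (auto simp: E_def)
    have "{0..<1} \<subseteq> (\<Union>i. E i)"
    proof
      fix x :: real assume x: "x \<in> {0..<1}"
      then have "(x, f x) \<in> (\<Union>i. U i)" using U by (auto simp: delta_covers_def)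
      then obtain i where "(x, f x) \<in> U i" by blast
      then show "x \<in> (\<Union>i. E i)" using E[of i] x by blast
    qed
    then have "emeasure lebesgue {0..<1::real} \<le> emeasure lebesgue (\<Union>i. E i)"
      using E by (intro emeasure_mono) auto
    also have "\<dots> \<le> (\<Sum>i. emeasure lebesgue (E i))"
      using E by (intro emeasure_subadditive_countably) auto
    also have "\<dots> \<le> (\<Sum>i. ennreal C * diam_power s (U i))"
    proof (rule suminf_le)
      show "emeasure lebesgue (E i) \<le> ennreal C * diam_power s (U i)" for i
        using E by blast
    qed auto
    also have "\<dots> = ennreal C * (\<Sum>i. diam_power s (U i))"
      by simp
    finally have "ennreal (1 / C) * 1 \<le> ennreal (1 / C) * (ennreal C * (\<Sum>i. diam_power s (U i)))"
      by (intro mult_left_mono) (auto simp: emeasure_lborel_Ico)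
    also have "\<dots> = (\<Sum>i. diam_power s (U i))"
      using C by (simp add: mult.assoc[symmetric] ennreal_mult[symmetric])
    finally show ?thesis by simp
  qed
  then have "ennreal (1 / C) \<le> hausdorff_premeasure s 1 ?G"
    unfolding hausdorff_premeasure_def by (rule INF_greatest)
  also have "\<dots> \<le> hausdorff_measure s ?G"
    unfolding hausdorff_measure_def by (rule SUP_upper) auto
  finally show ?thesis using C by auto
qed

section \<open>Upper bound: efficient grid coverings of the graph\<close>

context weierstrass_parameters
begin

text \<open>Holder continuity at b-adic scales by splitting at level \<open>n\<close>: the partial
  sum contributes its Lipschitz constant 4 * pi * (lam * b)^n times b^(-n), the tail lam^n times
  twice the sup bound 1 / (1 - lam).\<close>

lemma W_oscillation:
  obtains H where "0 < H" "\<And>x y n. \<bar>x - y\<bar> \<le> 1 / real b ^ n \<Longrightarrow> \<bar>W x - W y\<bar> \<le> H * lam ^ n"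
proof
  let ?H = "4 * pi + 2 / (1 - lam)"
  show "0 < ?H" using lam_upper by (intro add_pos_pos) auto
  show "\<bar>W x - W y\<bar> \<le> ?H * lam ^ n" if "\<bar>x - y\<bar> \<le> 1 / real b ^ n" for x y n
  proof -
    have "\<bar>partial n x - partial n y\<bar> \<le> 4 * pi * (lam * b) ^ n * \<bar>x - y\<bar>"
      using field_differentiable_bound[of UNIV "partial n" "partial_deriv n" "4 * pi * (lam * b) ^ n" y x]
        partial_has_derivative abs_partial_deriv_le by (simp add: abs_minus_commute)
    also have "\<dots> \<le> 4 * pi * (lam * b) ^ n * (1 / real b ^ n)"
      using that lam_pos by (intro mult_left_mono) auto
    also have "\<dots> = 4 * pi * lam ^ n"
      using b_pos by (simp add: power_mult_distrib)
    finally have 1: "\<bar>partial n x - partial n y\<bar> \<le> 4 * pi * lam ^ n" .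
    have "\<bar>W (real b ^ n * x) - W (real b ^ n * y)\<bar> \<le> 2 / (1 - lam)"
      using abs_W_le[of "real b ^ n * x"] abs_W_le[of "real b ^ n * y"] by (simp add: field_simps) 
    then have 2: "\<bar>lam ^ n * (W (real b ^ n * x) - W (real b ^ n * y))\<bar> \<le> lam ^ n * (2 / (1 - lam))"
      unfolding abs_mult using lam_pos by (intro mult_mono) auto
    have "W x - W y = (partial n x - partial n y) + lam ^ n * (W (real b ^ n * x) - W (real b ^ n * y))"
      using W_split[of x n] W_split[of y n] by (simp add: right_diff_distrib)
    moreover have "?H * lam ^ n = 4 * pi * lam ^ n + lam ^ n * (2 / (1 - lam))"
      by (simp add: distrib_right)
    ultimately show ?thesis using 1 2 by linarith
  qed
qed

text \<open>Over each of the b^n columns of width b^(-n) the graph varies by order lam^n, so about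
  (lam * b)^n squares per column suffice. The total count is of order (lam * b^2)^n, each square
  costing at most (2 / b^n)^s.\<close>

lemma grid_cover:
  assumes H: "0 < H" "\<And>x y n. \<bar>x - y\<bar> \<le> 1 / real b ^ n \<Longrightarrow> \<bar>W x - W y\<bar> \<le> H * lam ^ n"
    and s: "0 < s"
  shows "\<exists>U\<in>delta_covers (2 / real b ^ n) {(x, W x) | x. x \<in> {0..<1}}.
    (\<Sum>i. diam_power s (U i)) \<le> ennreal ((2 * H + 2) * 2 powr s * (lam * real b ^ 2 / real b powr s) ^ n)"
proof -
  let ?G = "{(x, W x) | x. x \<in> {0..<1}}"
  define B where "B = real b ^ n"
  define L where "L = lam ^ n"
  have B: "0 < B" using b_pos by (simp add: B_def)
  have L: "0 < L" using lam_pos by (simp add: L_def)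
  have LB: "1 \<le> L * B" using one_le_power[of "lam * b" n] lam_b by (simp add: L_def B_def power_mult_distrib)
  \<comment> \<open>Enough squares of side \<open>1 / B\<close> to fill a column of height
    \<open>2 * H * L\<close>; the 1 compensates for rounding down and is absorbed into
    \<open>2 * H + 2\<close> through \<open>1 \<le> L * B\<close>.\<close>
  define M where "M = nat \<lfloor>2 * H * (L * B)\<rfloor> + 1"
  have "0 \<le> 2 * H * (L * B)" using H L B by simp
  then have M: "0 < M" "real M \<le> 2 * H * (L * B) + 1" "2 * H * (L * B) < real M"
    unfolding M_def by (auto simp: le_nat_floor) linarith+
  define lo where "lo i j = W (real i / B) - H * L + real j / B" for i j :: nat
  define Q where "Q i j = {real i / B..(real i + 1) / B} \<times> {lo i j..lo i j + 1 / B}" for i j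
  \<comment> \<open>A single sequence lists the grid, with \<open>k div M\<close> the column and
    \<open>k mod M\<close> the row; the empty sets after it contribute 0.\<close>
  define U where "U k = (if k < b ^ n * M then Q (k div M) (k mod M) else {})" for k
  have bQ: "bounded (Q i j)" for i j
    unfolding Q_def by (intro bounded_Times) auto
  have dQ: "diameter (Q i j) \<le> 2 / B" for i j
  proof (rule diameter_le)
    show "norm (u - v) \<le> 2 / B" if "u \<in> Q i j" "v \<in> Q i j" for u v
    proof -
      have "norm (u - v) \<le> norm (fst u - fst v) + norm (snd u - snd v)"
        by (metis fst_diff norm_Pair_le prod.collapse snd_diff)
      also have "\<dots> \<le> 1 / B + 1 / B"
        using that by (intro add_mono) (auto simp: Q_def add_divide_distrib abs_le_iff)
      finally show ?thesis by simp
    qed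
  qed (use B in auto)
  have cover: "?G \<subseteq> (\<Union>k. U k)"
  proof
    fix z assume "z \<in> ?G"
    then obtain x where x: "z = (x, W x)" "0 \<le> x" "x < 1" by auto
    define i where "i = nat \<lfloor>x * B\<rfloor>"
    have "0 \<le> x * B" "x * B < B" using x B by auto
    then have i: "real i \<le> x * B" "x * B < real i + 1" "real i < B"
      unfolding i_def by linarith+
    then have ib: "i < b ^ n" unfolding B_def by (metis of_nat_less_iff of_nat_power)
    have xi: "real i / B \<le> x" "x \<le> (real i + 1) / B" using i B by (auto simp: field_simps)
    then have "\<bar>x - real i / B\<bar> \<le> 1 / real b ^ n"
      by (simp add: B_def add_divide_distrib)
    then have W: "\<bar>W x - W (real i / B)\<bar> \<le> H * L" unfolding L_def by (rule H(2))
    define y where "y = (W x - W (real i / B) + H * L) * B"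
    define j where "j = nat \<lfloor>y\<rfloor>"
    have y: "0 \<le> y" "y \<le> 2 * H * (L * B)"
    proof -
      have "0 \<le> W x - W (real i / B) + H * L" "W x - W (real i / B) + H * L \<le> 2 * (H * L)" using W by auto
      then have "0 \<le> y" "y \<le> 2 * (H * L) * B" unfolding y_def using B by (auto intro: mult_right_mono)
      then show "0 \<le> y" "y \<le> 2 * H * (L * B)" by (simp_all add: mult_ac)
    qed
    then have j: "real j \<le> y" "y \<le> real j + 1" "real j < real M" using M unfolding j_def by linarith+
    have Wy: "W x = W (real i / B) - H * L + y / B" using B by (simp add: y_def)
    have "y / B \<le> real j / B + 1 / B" "real j / B \<le> y / B"
      using j B by (simp_all add: divide_right_mono flip: add_divide_distrib)
    then have zQ: "z \<in> Q i j" using x xi by (simp add: Q_def lo_def Wy)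
    have "i * M + j < Suc i * M" using j by simp
    also have "\<dots> \<le> b ^ n * M" using ib by (intro mult_right_mono) auto
    finally have "U (i * M + j) = Q i j" using j by (simp add: U_def)
    then show "z \<in> (\<Union>k. U k)" using zQ by blast
  qed
  have "U \<in> delta_covers (2 / real b ^ n) ?G"
    unfolding delta_covers_def using cover bQ dQ B by (auto simp: U_def B_def)
  moreover have "(\<Sum>k. diam_power s (U k)) \<le> ennreal ((2 * H + 2) * 2 powr s * (lam * real b ^ 2 / real b powr s) ^ n)"
  proof -
    have "(\<Sum>k. diam_power s (U k)) = (\<Sum>k<b ^ n * M. diam_power s (U k))"
      by (rule suminf_finite) (auto simp: U_def diam_power_def)
    also have "\<dots> \<le> (\<Sum>k<b ^ n * M. ennreal ((2 / B) powr s))"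
    proof (intro sum_mono)
      fix k assume "k \<in> {..<b ^ n * M}"
      then have "diameter (U k) powr s \<le> (2 / B) powr s"
        using dQ bQ s by (intro powr_mono2) (auto simp: U_def diameter_ge_0)
      then show "diam_power s (U k) \<le> ennreal ((2 / B) powr s)"
        using s by (auto simp: diam_power_def ennreal_leI)
    qed
    also have "\<dots> = ennreal (B * real M * (2 / B) powr s)"
      by (simp add: B_def ennreal_mult ennreal_of_nat_eq_real_of_nat)
    also have "\<dots> \<le> ennreal ((2 * H + 2) * 2 powr s * (lam * real b ^ 2 / real b powr s) ^ n)"
    proof (rule ennreal_leI)
      have p: "(2 / B) powr s = 2 powr s / (real b powr s) ^ n"
        using b_pos by (simp add: B_def powr_divide powr_powr powr_realpow[symmetric] mult.commute)
      have "B * real M * (2 / B) powr s \<le> B * ((2 * H + 2) * (L * B)) * (2 / B) powr s"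
        using M LB B by (intro mult_right_mono mult_left_mono) (auto simp: algebra_simps)
      also have "\<dots> = (2 * H + 2) * 2 powr s * (lam * real b ^ 2 / real b powr s) ^ n"
        unfolding p by (simp add: B_def L_def power_divide power_mult_distrib power2_eq_square mult_ac)
      finally show "B * real M * (2 / B) powr s \<le>
          (2 * H + 2) * 2 powr s * (lam * real b ^ 2 / real b powr s) ^ n" .
    qed
    finally show ?thesis .
  qed
  ultimately show ?thesis by blast
qed

lemma dimension_ge_one: "1 \<le> 2 + ln lam / ln b"
proof -
  have "0 \<le> ln (lam * b)" using lam_b by (intro ln_ge_zero) simp
  also have "\<dots> = ln lam + ln b" using lam_pos b_pos by (simp add: ln_mult)
  finally show ?thesis using b by (simp add: field_simps)
qed

lemma hausdorff_measure_W_eq_0: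
  assumes s: "2 + ln lam / ln b < s"
  shows "hausdorff_measure s {(x, W x) | x. x \<in> {0..<1}} = 0"
proof (rule hausdorff_measure_eq_0I)
  fix \<delta> e :: real assume \<delta>: "0 < \<delta>" and e: "0 < e"
  obtain H where H: "0 < H" "\<And>x y n. \<bar>x - y\<bar> \<le> 1 / real b ^ n \<Longrightarrow> \<bar>W x - W y\<bar> \<le> H * lam ^ n"
    using W_oscillation by blast
  have s0: "0 < s" using s dimension_ge_one by linarith
  \<comment> \<open>Growth factor per level of the cost in \<open>grid_cover\<close>. It drops below
    1 exactly when \<open>s\<close> exceeds 2 + ln lam / ln b.\<close>
  define r where "r = lam * real b ^ 2 / real b powr s"
  have r0: "0 < r" using lam_pos b_pos by (simp add: r_def)
  have "r < 1"
  proof -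
    have "ln lam + 2 * ln b < s * ln b" using s b by (simp add: field_simps)
    moreover have "ln (lam * real b ^ 2) = ln lam + 2 * ln b"
      using lam_pos b_pos by (simp add: ln_mult ln_realpow)
    ultimately have "ln (lam * real b ^ 2) < ln (real b powr s)" using b_pos by (simp add: ln_powr)
    then have "lam * real b ^ 2 < real b powr s" using lam_pos b_pos by (subst (asm) ln_less_cancel_iff) auto
    then show ?thesis using b_pos by (simp add: r_def divide_less_eq)
  qed
  then have "(\<lambda>n. (2 * H + 2) * 2 powr s * r ^ n) \<longlonglongrightarrow> (2 * H + 2) * 2 powr s * 0"
    using r0 by (intro tendsto_mult[OF tendsto_const] LIMSEQ_realpow_zero) auto
  then have ev1: "\<forall>\<^sub>F n in sequentially. (2 * H + 2) * 2 powr s * r ^ n < e"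
    using e by (intro order_tendstoD) auto
  have "(\<lambda>n. 2 * (1 / real b) ^ n) \<longlonglongrightarrow> 2 * 0"
    using b by (intro tendsto_mult[OF tendsto_const] LIMSEQ_realpow_zero) auto
  then have ev2: "\<forall>\<^sub>F n in sequentially. 2 * (1 / real b) ^ n < \<delta>"
    using \<delta> by (intro order_tendstoD) auto
  obtain n where n: "(2 * H + 2) * 2 powr s * r ^ n < e" "2 * (1 / real b) ^ n < \<delta>"
    using eventually_happens'[OF _ eventually_conj[OF ev1 ev2]] by auto
  from grid_cover[OF H s0, of n] obtain U where
    U: "U \<in> delta_covers (2 / real b ^ n) {(x, W x) | x. x \<in> {0..<1}}"
      "(\<Sum>i. diam_power s (U i)) \<le> ennreal ((2 * H + 2) * 2 powr s * r ^ n)"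
    unfolding r_def by blast
  have "U \<in> delta_covers \<delta> {(x, W x) | x. x \<in> {0..<1}}"
  proof -
    have "2 / real b ^ n \<le> \<delta>" using n(2) by (simp add: power_divide)
    then show ?thesis using U(1) unfolding delta_covers_def by (auto intro: order_trans)
  qed
  moreover have "(\<Sum>i. diam_power s (U i)) \<le> ennreal e"
    by (rule order_trans[OF U(2)]) (use n(1) in \<open>simp add: ennreal_leI\<close>)
  ultimately show "\<exists>U\<in>delta_covers \<delta> {(x, W x) | x. x \<in> {0..<1}}. (\<Sum>i. diam_power s (U i)) \<le> ennreal e"
    by blast
qed

lemma hausdorff_dim_W:
  assumes "oscillatory_decay b lam \<beta> c" "0 < \<beta>" "0 < c"
  shows "hausdorff_dim {(x, W x) | x. x \<in> {0..<1}} = ereal (2 + ln lam / ln b)"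
proof (rule antisym)
  show "hausdorff_dim {(x, W x) | x. x \<in> {0..<1}} \<le> ereal (2 + ln lam / ln b)"
    using dimension_ge_one hausdorff_measure_W_eq_0 by (intro hausdorff_dim_le) auto
  obtain C where C: "0 < C" "\<And>d q p. 0 < d \<Longrightarrow> d \<le> 1 \<Longrightarrow> p \<in> {0..<1} \<Longrightarrow>
    emeasure lebesgue {x\<in>{0..<1}. \<bar>x - p\<bar> \<le> d \<and> \<bar>W x - q\<bar> \<le> d} \<le> ennreal (C * d powr (2 + ln lam / ln b))"
    using rectangle_measure_le[OF assms] by blast
  show "ereal (2 + ln lam / ln b) \<le> hausdorff_dim {(x, W x) | x. x \<in> {0..<1}}"
    using dimension_ge_one
    by (intro hausdorff_dim_ge hausdorff_measure_graph_nonzero[OF continuous_W C(1) _ _ _ C(2)]) auto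
qed

end

theorem theorem2p3:
  fixes g :: "real \<Rightarrow> real"
  assumes g: "\<And>u. g u = cos (2 * pi * u)"
  shows "\<forall>b::nat. 2 \<le> b \<longrightarrow>
    (\<exists>lam_b::real. lam_b < 1 \<and>
      (\<forall>lam::real. lam_b < lam \<longrightarrow> lam < 1 \<longrightarrow> 0 < lam \<longrightarrow> 1 < real b * lam \<longrightarrow>
        hausdorff_dim {(x, weierstrass_fun g lam b x) | x. x \<in> {0..<1::real}}
          = ereal (2 + ln lam / ln (real b))))"
proof (intro allI impI)
  fix b :: nat assume b: "2 \<le> b"
  have g_eq: "g = (\<lambda>u. cos (2 * pi * u))" using g by auto
  obtain lam_b where lam_b: "lam_b < 1" "\<And>lam. lam_b < lam \<Longrightarrow> lam < 1 \<Longrightarrow>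
      3 / 4 \<le> lam \<and> (\<exists>\<beta>>0. \<exists>c>0. oscillatory_decay b lam \<beta> c)"
    using oscillatory_decay_near_one[OF b] by blast
  have "hausdorff_dim {(x, weierstrass_fun g lam b x) | x. x \<in> {0..<1::real}} = ereal (2 + ln lam / ln (real b))"
    if lam: "lam_b < lam" "lam < 1" for lam
  proof -
    obtain \<beta> c where "oscillatory_decay b lam \<beta> c" "0 < \<beta>" "0 < c"
      using lam_b(2)[OF lam] by blast
    moreover have "weierstrass_parameters b lam"
      using b lam lam_b(2)[OF lam] by unfold_locales auto
    ultimately show ?thesis
      unfolding g_eq by (intro weierstrass_parameters.hausdorff_dim_W)
  qed
  then show "\<exists>lam_b::real. lam_b < 1 \<and>
      (\<forall>lam::real. lam_b < lam \<longrightarrow> lam < 1 \<longrightarrow> 0 < lam \<longrightarrow> 1 < real b * lam \<longrightarrow>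
        hausdorff_dim {(x, weierstrass_fun g lam b x) | x. x \<in> {0..<1::real}}
          = ereal (2 + ln lam / ln (real b)))"
    using lam_b(1) by blast
qed

end
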